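(* Let $G$ be a graph with turn costs $\alpha$ that are all positive, and let $r$ be the ratio between the maximum and minimum turn cost. Then a threading of $G$ whose turn cost is at most $2r$ times the minimum turn cost of any threading of $G$ can be computed in $O(m)$ time, where $m$ is the number of edges of $G$.
   Context: All graphs are connected with minimum degree at least $2$; $G=(V,E)$, $m=|E|$. A turn at a vertex $v$ is an unordered pair of distinct edges both incident to $v$. Turn costs for $G$ are a function $\alpha$ assigning a nonnegative real number to every turn of $G$. For a closed walk $W$, its turn cost $\alpha(W)$ is the sum of the costs of all consecutive pairs of edges of $W$, taken cyclically. The junction graph $J(v)$ induced by a closed walk at vertex $v$ has one vertex for each edge incident to $v$, and an edge between two of these vertices every time the walk visits $v$ immediately in between traversing the corresponding two edges. A threading of $G$ is a closed walk in $G$ that traverses every edge at least once, has no U-turns (never traverses the same edge twice in immediate succession, cyclically), and induces a connected junction graph at every vertex. *)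

theory Defs
  imports Complex_Main "HOL-Library.Multiset" "HOL-Library.Landau_Symbols"
begin

section \<open>Graphs\<close>

text \<open>Edges are sets of vertices: one-element sets (loops) are allowed here, because
  \<open>connected_graph\<close> is also used for junction graphs, and are excluded in \<open>simple_graph\<close>.\<close>

definition connected_graph :: "'a set \<Rightarrow> 'a set set \<Rightarrow> bool" where
  "connected_graph V E \<longleftrightarrow>
     V \<noteq> {} \<and> (\<forall>u\<in>V. \<forall>v\<in>V. (u, v) \<in> {(x, y). {x, y} \<in> E}\<^sup>*)"

definition simple_graph :: "'a set \<Rightarrow> 'a set set \<Rightarrow> bool" where
  "simple_graph V E \<longleftrightarrow> finite V \<and> (\<forall>e\<in>E. e \<subseteq> V \<and> card e = 2)"

definition incident_edges :: "'a set set \<Rightarrow> 'a \<Rightarrow> 'a set set" where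
  "incident_edges E v = {e \<in> E. v \<in> e}"

definition threadable_graph :: "'a set \<Rightarrow> 'a set set \<Rightarrow> bool" where
  "threadable_graph V E \<longleftrightarrow>
     simple_graph V E \<and> connected_graph V E \<and> (\<forall>v\<in>V. card (incident_edges E v) \<ge> 2)"


section \<open>Turns and turn costs\<close>

definition turns_at :: "'a set set \<Rightarrow> 'a \<Rightarrow> 'a set set set" where
  "turns_at E v = {{e, f} | e f. e \<in> incident_edges E v \<and> f \<in> incident_edges E v \<and> e \<noteq> f}"

definition turns :: "'a set \<Rightarrow> 'a set set \<Rightarrow> 'a set set set" where
  "turns V E = (\<Union>v\<in>V. turns_at E v)"

definition turn_cost_ratio :: "'a set \<Rightarrow> 'a set set \<Rightarrow> ('a set set \<Rightarrow> real) \<Rightarrow> real" where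
  "turn_cost_ratio V E \<alpha> = Max (\<alpha> ` turns V E) / Min (\<alpha> ` turns V E)"


section \<open>Closed walks and threadings\<close>

text \<open>A closed walk is the cyclic list of the vertices that it visits. Its \<open>i\<close>-th edge leads
  from the \<open>i\<close>-th vertex to the next one; the pair of its \<open>i\<close>-th edge and the following edge
  is taken at the vertex between them.\<close>

definition walk_edge :: "'a list \<Rightarrow> nat \<Rightarrow> 'a set" where
  "walk_edge W i = {W ! i, W ! (Suc i mod length W)}"

definition closed_walk :: "'a set set \<Rightarrow> 'a list \<Rightarrow> bool" where
  "closed_walk E W \<longleftrightarrow> W \<noteq> [] \<and> (\<forall>i < length W. walk_edge W i \<in> E)"

definition walk_pair :: "'a list \<Rightarrow> nat \<Rightarrow> 'a set set" where
  "walk_pair W i = {walk_edge W i, walk_edge W (Suc i mod length W)}"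

definition walk_pair_vertex :: "'a list \<Rightarrow> nat \<Rightarrow> 'a" where
  "walk_pair_vertex W i = W ! (Suc i mod length W)"

definition walk_cost :: "('a set set \<Rightarrow> real) \<Rightarrow> 'a list \<Rightarrow> real" where
  "walk_cost \<alpha> W = (\<Sum>i<length W. \<alpha> (walk_pair W i))"

definition has_u_turn :: "'a list \<Rightarrow> bool" where
  "has_u_turn W \<longleftrightarrow> (\<exists>i < length W. walk_edge W i = walk_edge W (Suc i mod length W))"

definition junction_vertices :: "'a set set \<Rightarrow> 'a \<Rightarrow> 'a set set" where
  "junction_vertices E v = incident_edges E v"

definition junction_edges :: "'a list \<Rightarrow> 'a \<Rightarrow> 'a set set multiset" where
  "junction_edges W v =
     image_mset (walk_pair W) (mset_set {i. i < length W \<and> walk_pair_vertex W i = v})"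

definition threading :: "'a set \<Rightarrow> 'a set set \<Rightarrow> 'a list \<Rightarrow> bool" where
  "threading V E W \<longleftrightarrow>
     closed_walk E W \<and>
     (\<forall>e\<in>E. \<exists>i < length W. walk_edge W i = e) \<and>
     \<not> has_u_turn W \<and>
     (\<forall>v\<in>V. connected_graph (junction_vertices E v) (set_mset (junction_edges W v)))"

text \<open>For positive turn costs the infimum is attained, because only finitely many threadings
  have a cost below any given bound.\<close>

definition min_threading_cost :: "'a set \<Rightarrow> 'a set set \<Rightarrow> ('a set set \<Rightarrow> real) \<Rightarrow> real" where
  "min_threading_cost V E \<alpha> = Inf (walk_cost \<alpha> ` {W. threading V E W})"


section \<open>Random access machines\<close>

text \<open>The model of computation is a word RAM that can also handle real numbers, as in the real
  RAM, since turn costs are real. A word is a natural number that is at most a bound \<open>B\<close>. The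
  memory consists of arrays of words and arrays of reals; a program names arrays by constants,
  so that it uses only finitely many of them, and uses cell \<open>0\<close> of an array as a variable. Turn
  costs are an input with random access: \<open>RTurn a b\<close> is the cost of the turn formed by the edges
  with the numbers \<open>a\<close> and \<open>b\<close>. There is no conversion from reals to words; reals influence
  words only through comparisons.\<close>

datatype wop = WPlus | WMinus | WTimes | WDiv | WMod

datatype wexp = WConst nat | WRead nat wexp | WBin wop wexp wexp

datatype rop = RPlus | RMinus | RTimes | RDivide

datatype rexp = RConst int | RRead nat wexp | RTurn wexp wexp | RBin rop rexp rexp

datatype cond = WLess wexp wexp | RLess rexp rexp | Neg cond | Conj cond cond

datatype com =
    Skip
  | WAssign nat wexp wexp
  | RAssign nat wexp rexp
  | Seq com com
  | Branch cond com com
  | Loop cond com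

record ram_state =
  wmem :: "nat \<Rightarrow> nat \<Rightarrow> nat"
  rmem :: "nat \<Rightarrow> nat \<Rightarrow> real"

fun wop_val :: "wop \<Rightarrow> nat \<Rightarrow> nat \<Rightarrow> nat" where
  "wop_val WPlus x y = x + y"
| "wop_val WMinus x y = x - y"
| "wop_val WTimes x y = x * y"
| "wop_val WDiv x y = x div y"
| "wop_val WMod x y = x mod y"

fun rop_val :: "rop \<Rightarrow> real \<Rightarrow> real \<Rightarrow> real" where
  "rop_val RPlus x y = x + y"
| "rop_val RMinus x y = x - y"
| "rop_val RTimes x y = x * y"
| "rop_val RDivide x y = x / y"

fun wval :: "ram_state \<Rightarrow> wexp \<Rightarrow> nat" where
  "wval s (WConst n) = n"
| "wval s (WRead A a) = wmem s A (wval s a)"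
| "wval s (WBin f a b) = wop_val f (wval s a) (wval s b)"

fun rval :: "(nat \<Rightarrow> nat \<Rightarrow> real) \<Rightarrow> ram_state \<Rightarrow> rexp \<Rightarrow> real" where
  "rval q s (RConst z) = of_int z"
| "rval q s (RRead A a) = rmem s A (wval s a)"
| "rval q s (RTurn a b) = q (wval s a) (wval s b)"
| "rval q s (RBin f x y) = rop_val f (rval q s x) (rval q s y)"

fun cval :: "(nat \<Rightarrow> nat \<Rightarrow> real) \<Rightarrow> ram_state \<Rightarrow> cond \<Rightarrow> bool" where
  "cval q s (WLess a b) \<longleftrightarrow> wval s a < wval s b"
| "cval q s (RLess x y) \<longleftrightarrow> rval q s x < rval q s y"
| "cval q s (Neg c) \<longleftrightarrow> \<not> cval q s c"
| "cval q s (Conj c d) \<longleftrightarrow> cval q s c \<and> cval q s d"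

text \<open>All intermediate results, including the addresses, have to be words.\<close>

fun wfits :: "nat \<Rightarrow> ram_state \<Rightarrow> wexp \<Rightarrow> bool" where
  "wfits B s (WConst n) \<longleftrightarrow> n \<le> B"
| "wfits B s (WRead A a) \<longleftrightarrow> wfits B s a \<and> wmem s A (wval s a) \<le> B"
| "wfits B s (WBin f a b) \<longleftrightarrow>
     wfits B s a \<and> wfits B s b \<and> wop_val f (wval s a) (wval s b) \<le> B"

fun rfits :: "nat \<Rightarrow> ram_state \<Rightarrow> rexp \<Rightarrow> bool" where
  "rfits B s (RConst z) \<longleftrightarrow> True"
| "rfits B s (RRead A a) \<longleftrightarrow> wfits B s a"
| "rfits B s (RTurn a b) \<longleftrightarrow> wfits B s a \<and> wfits B s b"
| "rfits B s (RBin f x y) \<longleftrightarrow> rfits B s x \<and> rfits B s y"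

fun cfits :: "nat \<Rightarrow> ram_state \<Rightarrow> cond \<Rightarrow> bool" where
  "cfits B s (WLess a b) \<longleftrightarrow> wfits B s a \<and> wfits B s b"
| "cfits B s (RLess x y) \<longleftrightarrow> rfits B s x \<and> rfits B s y"
| "cfits B s (Neg c) \<longleftrightarrow> cfits B s c"
| "cfits B s (Conj c d) \<longleftrightarrow> cfits B s c \<and> cfits B s d"

text \<open>Every operation, memory access and constant takes one unit of time.\<close>

fun wtime :: "wexp \<Rightarrow> nat" where
  "wtime (WConst n) = 1"
| "wtime (WRead A a) = 1 + wtime a"
| "wtime (WBin f a b) = 1 + wtime a + wtime b"

fun rtime :: "rexp \<Rightarrow> nat" where
  "rtime (RConst z) = 1"
| "rtime (RRead A a) = 1 + wtime a"
| "rtime (RTurn a b) = 1 + wtime a + wtime b"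
| "rtime (RBin f x y) = 1 + rtime x + rtime y"

fun ctime :: "cond \<Rightarrow> nat" where
  "ctime (WLess a b) = 1 + wtime a + wtime b"
| "ctime (RLess x y) = 1 + rtime x + rtime y"
| "ctime (Neg c) = 1 + ctime c"
| "ctime (Conj c d) = 1 + ctime c + ctime d"

definition wstore :: "nat \<Rightarrow> nat \<Rightarrow> nat \<Rightarrow> ram_state \<Rightarrow> ram_state" where
  "wstore A i x s = s\<lparr>wmem := (wmem s)(A := (wmem s A)(i := x))\<rparr>"

definition rstore :: "nat \<Rightarrow> nat \<Rightarrow> real \<Rightarrow> ram_state \<Rightarrow> ram_state" where
  "rstore A i x s = s\<lparr>rmem := (rmem s)(A := (rmem s A)(i := x))\<rparr>"

text \<open>\<open>ram_exec B q c s t s'\<close>: with words bounded by \<open>B\<close> and turn costs \<open>q\<close>, the program \<open>c\<close>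
  started in \<open>s\<close> terminates in \<open>s'\<close> after time \<open>t\<close>. There is no such run if the program does not
  terminate or if the word bound is exceeded.\<close>

inductive ram_exec ::
  "nat \<Rightarrow> (nat \<Rightarrow> nat \<Rightarrow> real) \<Rightarrow> com \<Rightarrow> ram_state \<Rightarrow> nat \<Rightarrow> ram_state \<Rightarrow> bool"
  for B q
where
  Skip: "ram_exec B q Skip s 1 s"
| WAssign: "wfits B s a \<Longrightarrow> wfits B s b \<Longrightarrow>
    ram_exec B q (WAssign A a b) s (1 + wtime a + wtime b) (wstore A (wval s a) (wval s b) s)"
| RAssign: "wfits B s a \<Longrightarrow> rfits B s x \<Longrightarrow>
    ram_exec B q (RAssign A a x) s (1 + wtime a + rtime x) (rstore A (wval s a) (rval q s x) s)"
| Seq: "ram_exec B q c s t s' \<Longrightarrow> ram_exec B q d s' t' s'' \<Longrightarrow>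
    ram_exec B q (Seq c d) s (t + t') s''"
| BranchTrue: "cfits B s b \<Longrightarrow> cval q s b \<Longrightarrow> ram_exec B q c s t s' \<Longrightarrow>
    ram_exec B q (Branch b c d) s (1 + ctime b + t) s'"
| BranchFalse: "cfits B s b \<Longrightarrow> \<not> cval q s b \<Longrightarrow> ram_exec B q d s t s' \<Longrightarrow>
    ram_exec B q (Branch b c d) s (1 + ctime b + t) s'"
| LoopFalse: "cfits B s b \<Longrightarrow> \<not> cval q s b \<Longrightarrow>
    ram_exec B q (Loop b c) s (1 + ctime b) s"
| LoopTrue: "cfits B s b \<Longrightarrow> cval q s b \<Longrightarrow> ram_exec B q c s t s' \<Longrightarrow>
    ram_exec B q (Loop b c) s' t' s'' \<Longrightarrow>
    ram_exec B q (Loop b c) s (1 + ctime b + t + t') s''"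

text \<open>The machine is deterministic, so that the existence of a run with some property says that
  the run of the program has this property.\<close>

inductive_cases ram_exec_SkipE: "ram_exec B q Skip s t s'"
inductive_cases ram_exec_WAssignE: "ram_exec B q (WAssign A a b) s t s'"
inductive_cases ram_exec_RAssignE: "ram_exec B q (RAssign A a x) s t s'"
inductive_cases ram_exec_SeqE: "ram_exec B q (Seq c d) s t s'"
inductive_cases ram_exec_BranchE: "ram_exec B q (Branch b c d) s t s'"
inductive_cases ram_exec_LoopE: "ram_exec B q (Loop b c) s t s'"

lemma ram_exec_deterministic:
  "ram_exec B q c s t s' \<Longrightarrow> ram_exec B q c s u s'' \<Longrightarrow> u = t \<and> s'' = s'"
proof (induction arbitrary: u s'' rule: ram_exec.induct)
  case Skip
  then show ?case by (elim ram_exec_SkipE) simp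
next
  case WAssign
  from WAssign.prems show ?case by (elim ram_exec_WAssignE) simp
next
  case RAssign
  from RAssign.prems show ?case by (elim ram_exec_RAssignE) simp
next
  case Seq
  from Seq.prems show ?case by (elim ram_exec_SeqE) (auto dest!: Seq.IH)
next
  case BranchTrue
  from BranchTrue.prems BranchTrue.hyps(1,2) show ?case
    by (elim ram_exec_BranchE) (auto dest!: BranchTrue.IH)
next
  case BranchFalse
  from BranchFalse.prems BranchFalse.hyps(1,2) show ?case
    by (elim ram_exec_BranchE) (auto dest!: BranchFalse.IH)
next
  case LoopFalse
  from LoopFalse.hyps show ?case
    by - (rule ram_exec_LoopE[OF LoopFalse.prems], simp_all)
next
  case LoopTrue
  from LoopTrue.hyps(1,2) show ?case
    by - (rule ram_exec_LoopE[OF LoopTrue.prems], auto dest!: LoopTrue.IH)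
qed


section \<open>Input and output\<close>

text \<open>A graph is given by numberings of its vertices and edges from \<open>0\<close>: \<open>vs\<close> lists the vertices,
  and \<open>es\<close> lists the edges as pairs of vertex numbers, in an arbitrary order and orientation.\<close>

definition edge_of :: "'a list \<Rightarrow> nat \<times> nat \<Rightarrow> 'a set" where
  "edge_of vs p = {vs ! fst p, vs ! snd p}"

definition represents :: "'a list \<Rightarrow> (nat \<times> nat) list \<Rightarrow> 'a set \<Rightarrow> 'a set set \<Rightarrow> bool" where
  "represents vs es V E \<longleftrightarrow>
     distinct vs \<and> set vs = V \<and>
     (\<forall>p \<in> set es. fst p < length vs \<and> snd p < length vs) \<and>
     distinct (map (edge_of vs) es) \<and> set (map (edge_of vs) es) = E"

text \<open>Array \<open>0\<close> holds the number of vertices, array \<open>1\<close> the number of edges, and arrays \<open>2\<close> and \<open>3\<close>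
  the ends of the edges. The rest of the memory is zero.\<close>

definition input_state :: "'a list \<Rightarrow> (nat \<times> nat) list \<Rightarrow> ram_state" where
  "input_state vs es =
     \<lparr>wmem = (\<lambda>A i.
        if A = 0 \<and> i = 0 then length vs
        else if A = 1 \<and> i = 0 then length es
        else if A = 2 \<and> i < length es then fst (es ! i)
        else if A = 3 \<and> i < length es then snd (es ! i)
        else 0),
      rmem = (\<lambda>A i. 0)\<rparr>"

definition turn_query ::
  "('a set set \<Rightarrow> real) \<Rightarrow> 'a list \<Rightarrow> (nat \<times> nat) list \<Rightarrow> 'a set \<Rightarrow> 'a set set \<Rightarrow> nat \<Rightarrow> nat \<Rightarrow> real"
where
  "turn_query \<alpha> vs es V E i j =
     (if i < length es \<and> j < length es \<and>
         {edge_of vs (es ! i), edge_of vs (es ! j)} \<in> turns V E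
      then \<alpha> {edge_of vs (es ! i), edge_of vs (es ! j)} else 0)"

text \<open>A closed walk is output as its length, in array \<open>4\<close>, and its vertex numbers, in array \<open>5\<close>.\<close>

definition outputs_walk :: "'a list \<Rightarrow> ram_state \<Rightarrow> 'a list \<Rightarrow> bool" where
  "outputs_walk vs s W \<longleftrightarrow>
     wmem s 4 0 = length W \<and>
     (\<forall>i < length W. wmem s 5 i < length vs \<and> vs ! wmem s 5 i = W ! i)"

end

theory Submission
  imports Defs
begin

text \<open>A threading has at least \<open>m\<close> turns, so a threading with \<open>2 * m\<close> turns is good enough. We look
  for one that traverses every edge twice and whose junction graph at every vertex is a cycle. Such
  a closed walk is the boundary of a (possibly nonorientable) ribbon graph on \<open>G\<close> with a single
  face. Arbitrary cyclic orders of the edges at the vertices give a ribbon graph with several faces,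
  and twisting an edge whose two sides lie on different faces merges these two faces without
  changing any junction graph. Since \<open>G\<close> is connected, a search through the faces finds a set of
  edges whose twisting leaves one face, in time \<open>O(m)\<close>.\<close>

section \<open>Pairs of involutions\<close>

text \<open>Twists cannot be avoided in general: by Euler's formula, an orientable ribbon graph with
  one face requires that the number of vertices minus \<open>m\<close> is odd, whatever the cyclic
  orders are. The reason why a twist merges is that a face is a cycle in which two fixed-point-free
  involutions alternate. Losing one edge side turns each of the two cycles into a path, and the two
  new sides join these paths. Twisting changes the faces, and tracing a merged face again would cost
  too much time. The search therefore traces the faces of the untwisted map throughout, each of them
  once, and only maintains that the visited flags lie in one component of the map twisted so far.
  The order in which the merged face runs through them is of no concern until the end, when there is
  a single component and following the involutions from any flag lists it completely.\<close>

definition adj :: "('b \<Rightarrow> 'b) \<Rightarrow> ('b \<Rightarrow> 'b) \<Rightarrow> 'b rel" where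
  "adj L R = {(x, y). y = L x \<or> y = R x}"

locale free_involutions =
  fixes X :: "'b set" and L R :: "'b \<Rightarrow> 'b"
  assumes finite_X: "finite X"
    and L_closed: "x \<in> X \<Longrightarrow> L x \<in> X" and R_closed: "x \<in> X \<Longrightarrow> R x \<in> X"
    and L_L: "x \<in> X \<Longrightarrow> L (L x) = x" and R_R: "x \<in> X \<Longrightarrow> R (R x) = x"
    and L_free: "x \<in> X \<Longrightarrow> L x \<noteq> x" and R_free: "x \<in> X \<Longrightarrow> R x \<noteq> x"
begin

definition turn where "turn i x = ((\<lambda>y. L (R y)) ^^ i) x"

lemma turn_simps [simp]: "turn 0 x = x" "turn (Suc i) x = L (R (turn i x))"
  by (simp_all add: turn_def)

lemma turn_add: "turn (i + j) x = turn i (turn j x)"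
  by (induction i) auto

lemma turn_closed: "x \<in> X \<Longrightarrow> turn i x \<in> X"
  by (induction i) (auto intro: L_closed R_closed)

text \<open>Cancelling \<open>L\<close> and \<open>R\<close> turns an equality for \<open>i\<close>
  and \<open>d\<close> into one for \<open>i + 1\<close> and \<open>d - 2\<close>. The descent ends
  in a fixed point of \<open>R\<close> if \<open>d = 0\<close> and of \<open>L\<close> if
  \<open>d = 1\<close>.\<close>

lemma R_turn_neq_le:
  assumes "x \<in> X"
  shows "R (turn i x) \<noteq> turn (i + d) x"
proof (induction d arbitrary: i rule: less_induct)
  case (less d)
  note c = turn_closed[OF assms]
  show ?case
  proof
    assume eq: "R (turn i x) = turn (i + d) x"
    consider "d = 0" | "d = 1" | d' where "d = Suc (Suc d')"
      by (metis One_nat_def not0_implies_Suc)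
    then show False
    proof cases
      case 1
      then show False using eq R_free c by simp
    next
      case 2
      then show False using eq L_free[OF R_closed[OF c[of i]]] by simp
    next
      case 3
      then have "L (R (turn i x)) = L (L (R (turn (i + Suc d') x)))"
        using eq by simp
      then have "L (R (turn i x)) = R (turn (i + Suc d') x)"
        by (simp only: L_L[OF R_closed[OF c]])
      then have "R (turn (Suc i) x) = turn (Suc i + d') x"
        using R_R c by (metis add_Suc add_Suc_right turn_simps(2))
      then show False using less.IH[of d' "Suc i"] 3 by simp
    qed
  qed
qed

lemma R_turn_neq:
  assumes "x \<in> X"
  shows "R (turn i x) \<noteq> turn j x"
proof (cases "i \<le> j")
  case True
  then show ?thesis using R_turn_neq_le[OF assms, of i "j - i"] by simp
next
  case False
  then have "R (turn j x) \<noteq> turn i x" using R_turn_neq_le[OF assms, of j "i - j"] by simp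
  then show ?thesis using R_R turn_closed[OF assms] by metis
qed

lemma turn_inj:
  assumes "x \<in> X" "y \<in> X" "turn i x = turn i y"
  shows "x = y"
  using assms(3)
proof (induction i)
  case (Suc i)
  then show ?case
    using assms(1,2) turn_closed by (metis L_L R_R R_closed turn_simps(2))
qed simp

definition period where "period x = (LEAST p. 0 < p \<and> turn p x = x)"

lemma period:
  assumes "x \<in> X"
  shows "0 < period x" "turn (period x) x = x"
    "\<And>p. 0 < p \<Longrightarrow> p < period x \<Longrightarrow> turn p x \<noteq> x"
proof -
  have "\<not> inj_on (\<lambda>i. turn i x) {..card X}"
  proof
    assume "inj_on (\<lambda>i. turn i x) {..card X}"
    then have "card {..card X} \<le> card X"
      by (rule card_inj_on_le) (use turn_closed assms finite_X in auto)
    then show False by simp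
  qed
  then obtain i j where "i < j" "turn i x = turn j x"
    unfolding inj_on_def by (metis linorder_neqE_nat)
  then have "turn i x = turn i (turn (j - i) x)" by (simp flip: turn_add)
  then have "turn (j - i) x = x" using turn_inj assms turn_closed by metis
  then have ex: "\<exists>p. 0 < p \<and> turn p x = x" using \<open>i < j\<close> by (metis zero_less_diff)
  from LeastI_ex[OF this] show "0 < period x" "turn (period x) x = x"
    by (auto simp: period_def)
  show "\<And>p. 0 < p \<Longrightarrow> p < period x \<Longrightarrow> turn p x \<noteq> x"
    unfolding period_def by (drule not_less_Least) simp
qed

text \<open>The graph with the edges \<open>{x, L x}\<close> and \<open>{x, R x}\<close> is 2-regular, so it has no bridge.\<close>

lemma detour:
  assumes "x \<in> X"
  shows "(R x, x) \<in> {(y, z). y \<in> X \<and> z \<in> X \<and> (z = L y \<or> z = R y \<and> y \<noteq> x \<and> y \<noteq> R x)}\<^sup>*"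
    (is "_ \<in> ?r\<^sup>*")
proof -
  \<comment> \<open>The path starts with the step from \<open>R x\<close> along \<open>L\<close> and
    follows the orbit of \<open>x\<close> until it closes. It uses \<open>R\<close> only at
    \<open>turn i x\<close> with \<open>i\<close> strictly between 0 and the period, which is
    neither \<open>x\<close> nor \<open>R x\<close>.\<close>
  have "Suc i \<le> period x \<Longrightarrow> (R x, turn (Suc i) x) \<in> ?r\<^sup>*" for i
  proof (induction i)
    case 0
    show ?case using assms by (auto intro!: r_into_rtrancl L_closed R_closed)
  next
    case (Suc i)
    let ?y = "turn (Suc i) x"
    have y: "?y \<in> X" "?y \<noteq> x" "?y \<noteq> R x"
      using turn_closed[OF assms, of "Suc i"] period(3)[OF assms, of "Suc i"] Suc.prems
        R_turn_neq[OF assms, of 0 "Suc i"] by (auto simp del: turn_simps(2))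
    then have "(?y, R ?y) \<in> ?r" "(R ?y, turn (Suc (Suc i)) x) \<in> ?r"
      by (simp_all add: L_closed R_closed)
    then show ?case using Suc by (meson Suc_leD rtrancl.rtrancl_into_rtrancl)
  qed
  from this[of "period x - 1"] show ?thesis using period[OF assms] by (simp del: turn_simps)
qed

text \<open>A component of \<open>adj L R\<close> is a cycle of alternating \<open>L\<close> and
  \<open>R\<close> steps. The orbit of \<open>x\<close> consists of every second element, and
  \<open>R\<close> maps it bijectively to the others. This turns connectedness into a closed walk of
  known length.\<close>

lemma single_orbit:
  assumes x: "x \<in> X" and reach: "\<And>y. y \<in> X \<Longrightarrow> (x, y) \<in> (adj L R)\<^sup>*"
  shows "turn (card X div 2) x = x"
    and "\<And>y. y \<in> X \<Longrightarrow> \<exists>i < card X div 2. y = turn i x \<or> y = R (turn i x)"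
proof -
  let ?O = "(\<lambda>i. turn i x) ` {..<period x}"
  note c = turn_closed[OF x]
  have cover: "y \<in> ?O \<union> R ` ?O" if "(x, y) \<in> (adj L R)\<^sup>*" for y
    using that
  proof induction
    case base
    then show ?case using period(1)[OF x] by (force intro: image_eqI[where x = 0])
  next
    case (step y z)
    from step.IH obtain i where i: "i < period x" "y = turn i x \<or> y = R (turn i x)" by auto
    have R: "R y \<in> ?O \<union> R ` ?O" using i R_R c by auto
    have "L y \<in> ?O \<union> R ` ?O"
    proof (cases "y = turn i x")
      case True
      \<comment> \<open>The index of the predecessor in the orbit; before index 0 comes the last
        one.\<close>
      obtain j where j: "j < period x" "y = turn (Suc j) x"
      proof (cases i)
        case 0
        then show ?thesis using True that[of "period x - 1"] period[OF x]
          by (simp del: turn_simps(2))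
      next
        case (Suc j)
        then show ?thesis using that[of j] i True by simp
      qed
      then show ?thesis using L_L[OF R_closed[OF c]] by auto
    next
      case False
      then have *: "L y = turn (Suc i) x" using i by simp
      show ?thesis
      proof (cases "Suc i = period x")
        case True
        then have "L y = turn 0 x" using * period(2)[OF x] by simp
        then show ?thesis using period(1)[OF x] by (blast intro: image_eqI[where x = 0])
      next
        case False
        then have "Suc i < period x" using i(1) by simp
        then show ?thesis unfolding * by blast
      qed
    qed
    then show ?case using R step.hyps(2) by (auto simp: adj_def)
  qed
  have sub: "?O \<subseteq> X" using c by auto
  have "X = ?O \<union> R ` ?O" using cover reach sub R_closed by blast
  moreover have "?O \<inter> R ` ?O = {}" using R_turn_neq[OF x] by (auto dest: sym)
  moreover have "card (R ` ?O) = card ?O"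
    using sub R_R by (intro card_image inj_onI) (metis subsetD)
  moreover have "card ?O = period x"
  proof -
    have "inj_on (\<lambda>i. turn i x) {..<period x}"
    proof (rule linorder_inj_onI)
      fix i j assume ij: "i < j" "i \<in> {..<period x}" "j \<in> {..<period x}"
      have "turn j x = turn i (turn (j - i) x)" using ij by (simp flip: turn_add)
      moreover have "turn (j - i) x \<noteq> x" using period(3)[OF x, of "j - i"] ij by simp
      ultimately show "turn i x \<noteq> turn j x" using turn_inj x c by metis
    qed auto
    then show ?thesis by (simp add: card_image)
  qed
  ultimately have card: "card X = 2 * period x"
    by (metis card_Un_disjoint finite_imageI finite_lessThan mult_2)
  then show "turn (card X div 2) x = x" using period(2)[OF x] by simp
  fix y assume "y \<in> X"
  then show "\<exists>i < card X div 2. y = turn i x \<or> y = R (turn i x)"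
    using cover[OF reach] card by auto
qed

end

section \<open>Flags of a ribbon graph\<close>

text \<open>The flag \<open>4 * e + 2 * i + j\<close> is the side \<open>j\<close> of the end \<open>i\<close> of the edge \<open>e\<close>. The maps \<open>flip\<close>,
  \<open>cross\<close> and \<open>opposite\<close> are the bitwise exclusive or with \<open>1\<close>, \<open>2\<close> and \<open>3\<close>. In an untwisted edge the
  sides connect \<open>f\<close> with \<open>opposite f\<close>, in a twisted edge with \<open>cross f\<close>.\<close>

definition flip :: "nat \<Rightarrow> nat" where
  "flip f = (if even f then f + 1 else f - 1)"

definition opposite :: "nat \<Rightarrow> nat" where
  "opposite f = f + 3 - 2 * (f mod 4)"

definition cross :: "nat \<Rightarrow> nat" where
  "cross f = f + 2 - 4 * (f mod 4 div 2)"

lemma flag_cases: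
  obtains e where "f = 4 * e" | e where "f = 4 * e + 1" | e where "f = 4 * e + 2"
    | e :: nat where "f = 4 * e + 3"
proof -
  have "f = 4 * (f div 4) + f mod 4" "f mod 4 < 4" by simp_all
  moreover from this(2) have "f mod 4 = 0 \<or> f mod 4 = 1 \<or> f mod 4 = 2 \<or> f mod 4 = 3" by linarith
  ultimately show thesis by (metis that add_0_right)
qed

lemma flag_div:
  "4 * e div 4 = e" "(4 * e + 1) div 4 = e" "(4 * e + 2) div 4 = e" "(4 * e + 3) div 4 = e"
  "4 * e div 2 = 2 * e" "(4 * e + 1) div 2 = 2 * e"
  "(4 * e + 2) div 2 = 2 * e + 1" "(4 * e + 3) div 2 = 2 * e + 1" for e :: nat
  by linarith+

lemma flag_mod:
  "(4 * e + 1) mod 4 = 1" "(4 * e + 2) mod 4 = 2" "(4 * e + 3) mod 4 = 3" for e :: nat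
  by presburger+

lemma flag_maps_simps:
  "flip (4 * e) = 4 * e + 1" "flip (4 * e + 1) = 4 * e"
  "flip (4 * e + 2) = 4 * e + 3" "flip (4 * e + 3) = 4 * e + 2"
  "opposite (4 * e) = 4 * e + 3" "opposite (4 * e + 1) = 4 * e + 2"
  "opposite (4 * e + 2) = 4 * e + 1" "opposite (4 * e + 3) = 4 * e"
  "cross (4 * e) = 4 * e + 2" "cross (4 * e + 1) = 4 * e + 3"
  "cross (4 * e + 2) = 4 * e" "cross (4 * e + 3) = 4 * e + 1"
  unfolding flip_def opposite_def cross_def flag_mod by simp_all

lemma flag_maps [simp]:
  "flip (flip f) = f" "opposite (opposite f) = f" "cross (cross f) = f"
  "flip (opposite f) = cross f" "opposite (flip f) = cross f"
  "flip (cross f) = opposite f" "cross (flip f) = opposite f"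
  "opposite (cross f) = flip f" "cross (opposite f) = flip f"
  by (cases f rule: flag_cases; simp only: flag_maps_simps)+

lemma flag_maps_div [simp]:
  "flip f div 4 = f div 4" "opposite f div 4 = f div 4" "cross f div 4 = f div 4"
  "flip f div 2 = f div 2" "opposite f div 2 = cross f div 2"
  by (cases f rule: flag_cases; simp only: flag_maps_simps flag_div nonzero_mult_div_cancel_left; simp)+

lemma flag_maps_parity [simp]:
  "even (flip f) \<longleftrightarrow> odd f" "even (opposite f) \<longleftrightarrow> odd f" "even (cross f) \<longleftrightarrow> even f"
  by (cases f rule: flag_cases; simp only: flag_maps_simps; simp)+

lemma flag_maps_neq [simp]: "flip f \<noteq> f" "opposite f \<noteq> f" "cross f \<noteq> f"
  by (cases f rule: flag_cases; simp only: flag_maps_simps; simp)+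

text \<open>With the identity, the three flag maps form a Klein four-group, whose orbits are the
  flag sets of the edges.\<close>

lemma same_edge_flags:
  "f div 4 = g div 4 \<longleftrightarrow> f \<in> {g, opposite g, cross g, flip g}"
  by (cases f rule: flag_cases; cases g rule: flag_cases;
      simp only: flag_maps_simps flag_div nonzero_mult_div_cancel_left; simp; presburger)

lemma flag_less_iff: "f < 4 * m \<longleftrightarrow> f div 4 < (m :: nat)"
  by (simp add: div_less_iff_less_mult mult.commute)

text \<open>\<open>V h\<close> is the vertex of the half-edge \<open>h\<close>, and \<open>L f\<close> is the flag that follows or precedes \<open>f\<close>
  at its vertex: a walk that arrives in \<open>f\<close> leaves through \<open>L f\<close>.\<close>

definition linked :: "nat \<Rightarrow> (nat \<Rightarrow> 'v) \<Rightarrow> (nat \<Rightarrow> nat) \<Rightarrow> bool" where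
  "linked k V L \<longleftrightarrow>
     (\<forall>f<2*k. L f < 2 * k \<and> L (L f) = f \<and> (even (L f) \<longleftrightarrow> odd f) \<and> V (L f div 2) = V (f div 2)) \<and>
     (\<forall>f<2*k. \<forall>g<2*k. V (f div 2) = V (g div 2) \<longrightarrow> (f, g) \<in> (adj L flip)\<^sup>*)"

section \<open>Cyclic orders built by inserting half-edges one at a time\<close>

lemma linked_0: "linked 0 V L"
  by (simp add: linked_def)

lemma linked_cong:
  assumes "linked k V L" "\<And>i. i < k \<Longrightarrow> V' i = V i"
  shows "linked k V' L"
  using assms unfolding linked_def by (auto simp: less_mult_imp_div_less mult.commute)

lemma less_2_Suc: "f < 2 * Suc k \<longleftrightarrow> f < 2 * k \<or> f = 2 * k \<or> f = 2 * k + 1"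
  by auto

lemma flip_less: "f < 2 * k \<Longrightarrow> flip f < 2 * k"
  by (auto simp: flip_def elim!: evenE)

text \<open>A cyclic order with one element: the two sides of the half-edge are neighbours of each
  other.\<close>

lemma linked_insert_first:
  assumes L: "linked k V L" and new: "\<And>i. i < k \<Longrightarrow> V i \<noteq> V k"
  shows "linked (Suc k) V (L(2 * k := 2 * k + 1, 2 * k + 1 := 2 * k))"
    (is "linked _ _ ?L")
proof -
  have new': "V (f div 2) \<noteq> V k" if "f < 2 * k" for f
    using new[of "f div 2"] that by linarith
  have old: "(f, g) \<in> (adj ?L flip)\<^sup>*" if "(f, g) \<in> (adj L flip)\<^sup>*" "f < 2 * k" for f g
  proof -
    from that have "g < 2 * k \<and> (f, g) \<in> (adj ?L flip)\<^sup>*"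
    proof induction
      case (step y z)
      then have "z < 2 * k" "(y, z) \<in> adj ?L flip"
        using L flip_less by (auto simp: adj_def linked_def)
      with step show ?case by (meson rtrancl.rtrancl_into_rtrancl)
    qed simp
    then show ?thesis ..
  qed
  have "(2 * k, 2 * k + 1) \<in> (adj ?L flip)\<^sup>*" "(2 * k + 1, 2 * k) \<in> (adj ?L flip)\<^sup>*"
    by (auto simp: adj_def intro!: r_into_rtrancl)
  moreover have "(f, g) \<in> (adj ?L flip)\<^sup>*" if "f < 2 * k" "g < 2 * k" "V (f div 2) = V (g div 2)" for f g
    using old L that by (auto simp: linked_def)
  ultimately show ?thesis
    using L new' new'[symmetric] unfolding linked_def less_2_Suc by auto
qed

text \<open>The new half-edge is put between \<open>p\<close> and \<open>L p\<close>, so their link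
  becomes a path through \<open>2 * k\<close> and \<open>2 * k + 1\<close>. Links join flags of
  different parity; this is why \<open>p\<close>, the new partner of \<open>2 * k\<close>, is chosen
  odd.\<close>

lemma linked_insert_after:
  assumes L: "linked k V L" and j: "j < k" "V j = V k"
  defines "p \<equiv> 2 * j + 1"
  shows "linked (Suc k) V (L(p := 2 * k, 2 * k := p, 2 * k + 1 := L p, L p := 2 * k + 1))"
    (is "linked _ _ ?L")
proof -
  define y where "y = L p"
  have p: "p < 2 * k" "odd p" "p div 2 = j" using j by (auto simp: p_def)
  have y: "y < 2 * k" "even y" "L y = p" "V (y div 2) = V k" "L p = y"
    using L p j by (auto simp: linked_def y_def)
  have py: "p \<noteq> y" using p y by auto
  have L': "?L p = 2 * k" "?L (2 * k) = p" "?L (2 * k + 1) = y" "?L y = 2 * k + 1"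
    "\<And>f. f < 2 * k \<Longrightarrow> f \<noteq> p \<Longrightarrow> f \<noteq> y \<Longrightarrow> ?L f = L f"
    using p y py by (auto simp: fun_upd_apply)
  have other: "L f \<noteq> p" "L f \<noteq> y" if "f < 2 * k" "f \<noteq> p" "f \<noteq> y" for f
    using that L y by (auto simp: linked_def)
  have closed: "L f < 2 * k" "L (L f) = f" "even (L f) \<longleftrightarrow> odd f" "V (L f div 2) = V (f div 2)"
    if "f < 2 * k" for f
    using that L by (auto simp: linked_def)
  have step: "(f, ?L f) \<in> adj ?L flip" "(f, flip f) \<in> adj ?L flip" for f by (auto simp: adj_def)
  have flipk: "flip (2 * k) = 2 * k + 1" "flip (2 * k + 1) = 2 * k" by (auto simp: flip_def)
  have py_path: "(p, y) \<in> (adj ?L flip)\<^sup>*" "(p, 2 * k) \<in> (adj ?L flip)\<^sup>*" "(p, 2 * k + 1) \<in> (adj ?L flip)\<^sup>*"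
    using step(1)[of p] step(2)[of "2 * k"] step(1)[of "2 * k + 1"] unfolding L' flipk
    by (meson converse_rtrancl_into_rtrancl rtrancl.rtrancl_refl)+
  have yp_path: "(y, p) \<in> (adj ?L flip)\<^sup>*"
    using step(1)[of y] step(2)[of "2 * k + 1"] step(1)[of "2 * k"] unfolding L' flipk
    by (meson converse_rtrancl_into_rtrancl rtrancl.rtrancl_refl)
  have to_p: "(2 * k, p) \<in> (adj ?L flip)\<^sup>*" "(2 * k + 1, p) \<in> (adj ?L flip)\<^sup>*"
    using step(1)[of "2 * k"] step(2)[of "2 * k + 1"] unfolding L' flipk
    by (meson converse_rtrancl_into_rtrancl rtrancl.rtrancl_refl)+
  have old: "(f, g) \<in> (adj ?L flip)\<^sup>*" if "(f, g) \<in> (adj L flip)\<^sup>*" "f < 2 * k" for f g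
  proof -
    from that have "g < 2 * k \<and> (f, g) \<in> (adj ?L flip)\<^sup>*"
    proof induction
      case (step u w)
      then have "w < 2 * k" using closed flip_less by (auto simp: adj_def)
      moreover have "(u, w) \<in> (adj ?L flip)\<^sup>*"
      \<comment> \<open>Only a step along the destroyed link between \<open>p\<close> and
        \<open>y\<close> has to be rerouted.\<close>
      proof (cases "w = L u \<and> (u = p \<or> u = y)")
        case True
        then show ?thesis using py_path yp_path y by auto
      next
        case False
        have "w = L u \<or> w = flip u" using step.hyps(2) by (simp add: adj_def)
        then consider "w = L u" "u \<noteq> p" "u \<noteq> y" | "w = flip u" using False by blast
        then have "(u, w) \<in> adj ?L flip"
        proof cases
          case 1
          have "u < 2 * k" using step.IH step.prems by blast
          then show ?thesis unfolding adj_def using 1 L'(5)[OF _ 1(2,3)] by simp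
        next
          case 2
          then show ?thesis by (simp add: adj_def)
        qed
        then show ?thesis by (rule r_into_rtrancl)
      qed
      ultimately show ?case using step.IH step.prems by (meson rtrancl_trans)
    qed simp
    then show ?thesis ..
  qed
  have old': "(f, g) \<in> (adj ?L flip)\<^sup>*" if "f < 2 * k" "g < 2 * k" "V (f div 2) = V (g div 2)" for f g
    using old L that by (auto simp: linked_def)
  have via: "(f, p) \<in> (adj ?L flip)\<^sup>* \<and> (p, f) \<in> (adj ?L flip)\<^sup>*" if "f < 2 * Suc k" "V (f div 2) = V k" for f
    using that(1) unfolding less_2_Suc
  proof (elim disjE)
    assume "f < 2 * k"
    then show ?thesis using old' p that(2) j by simp
  next
    assume "f = 2 * k" then show ?thesis using to_p py_path by simp
  next
    assume "f = 2 * k + 1" then show ?thesis using to_p py_path by simp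
  qed
  have "(f, g) \<in> (adj ?L flip)\<^sup>*" if "f < 2 * Suc k" "g < 2 * Suc k" "V (f div 2) = V (g div 2)" for f g
  proof (cases "V (f div 2) = V k")
    case True
    then show ?thesis using via that by (metis rtrancl_trans)
  next
    case False
    then have "f < 2 * k" "g < 2 * k" using that unfolding less_2_Suc by auto
    then show ?thesis using old' that by simp
  qed
  moreover have "?L f < 2 * Suc k \<and> ?L (?L f) = f \<and> (even (?L f) \<longleftrightarrow> odd f) \<and> V (?L f div 2) = V (f div 2)"
    if f: "f < 2 * Suc k" for f
  proof -
    consider "f = p" | "f = y" | "f = 2 * k" | "f = 2 * k + 1" | "f < 2 * k" "f \<noteq> p" "f \<noteq> y"
      using f[unfolded less_2_Suc] by blast
    then show ?thesis
    proof cases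
      case 5
      then have "?L f = L f" "?L (L f) = f" using L'(5) other closed by auto
      then show ?thesis using closed[OF 5(1)] by simp
    qed (use L' p y j in \<open>simp_all only: L'\<close>, simp_all)
  qed
  ultimately show ?thesis unfolding linked_def by blast
qed

section \<open>Merging faces\<close>

definition edge_map :: "nat set \<Rightarrow> nat \<Rightarrow> nat" where
  "edge_map T f = (if f div 4 \<in> T then cross f else opposite f)"

lemma edge_map_simps [simp]:
  "edge_map T (edge_map T f) = f" "edge_map T f \<noteq> f" "edge_map T f div 4 = f div 4"
  by (simp_all add: edge_map_def)

locale link_map =
  fixes m :: nat and V :: "nat \<Rightarrow> 'v" and L :: "nat \<Rightarrow> nat"
  assumes linked: "linked (2 * m) V L"
begin

lemma L_simps:
  assumes "f < 4 * m"
  shows "L f < 4 * m" "L (L f) = f" "even (L f) \<longleftrightarrow> odd f" "V (L f div 2) = V (f div 2)" "L f \<noteq> f"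
proof -
  show *: "L f < 4 * m" "L (L f) = f" "even (L f) \<longleftrightarrow> odd f" "V (L f div 2) = V (f div 2)"
    using linked assms by (auto simp: linked_def)
  show "L f \<noteq> f" using *(3) by auto
qed

lemma maps_less [simp]:
  "flip f < 4 * m \<longleftrightarrow> f < 4 * m" "opposite f < 4 * m \<longleftrightarrow> f < 4 * m"
  "cross f < 4 * m \<longleftrightarrow> f < 4 * m" "edge_map T f < 4 * m \<longleftrightarrow> f < 4 * m"
  by (simp_all add: flag_less_iff)

text \<open>An even flag stands for an edge together with a direction. Their orbits under
  \<open>L \<circ> opposite\<close> are the faces of the untwisted map, so \<open>D\<close> is a union of faces.\<close>

definition face_closed :: "nat set \<Rightarrow> bool" where
  "face_closed D \<longleftrightarrow> D \<subseteq> {f. even f \<and> f < 4 * m} \<and> (\<forall>f\<in>D. L (opposite f) \<in> D)"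

text \<open>The face of the twisted map through the flag 0, as a set of flags.\<close>

definition reach :: "nat set \<Rightarrow> nat \<Rightarrow> bool" where
  "reach T f \<longleftrightarrow> (0, f) \<in> (adj L (edge_map T))\<^sup>*"

lemma reach_L: "reach T f \<Longrightarrow> reach T (L f)"
  and reach_edge_map: "reach T f \<Longrightarrow> reach T (edge_map T f)"
  unfolding reach_def by (auto simp: adj_def intro: rtrancl.rtrancl_into_rtrancl)

text \<open>The state between two traces: the visited faces of the untwisted map are parts of one
  face of the twisted map. As a twisted edge has both directions in \<open>D\<close>, no twist leads
  out of the visited part.\<close>

definition explored :: "nat set \<Rightarrow> nat set \<Rightarrow> bool" where
  "explored D T \<longleftrightarrow> face_closed D \<and> 0 \<in> D \<and> (\<forall>f. even f \<longrightarrow> f div 4 \<in> T \<longrightarrow> f \<in> D) \<and>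
     (\<forall>f\<in>D. reach T f \<and> reach T (opposite f))"

section \<open>Closure of the visited flags, and the effect of a twist\<close>

text \<open>An injective map of a finite set into itself permutes it, so closure under
  \<open>L\<close> after \<open>opposite\<close> entails closure under the inverse.\<close>

lemma face_closed_L:
  assumes D: "face_closed D" and f: "f \<in> D \<union> opposite ` D"
  shows "L f \<in> D \<union> opposite ` D"
proof (cases "f \<in> D")
  case True
  have "inj_on (\<lambda>f. L (opposite f)) D"
  proof (rule inj_onI)
    fix x y assume "x \<in> D" "y \<in> D" "L (opposite x) = L (opposite y)"
    moreover from this have "opposite x < 4 * m" "opposite y < 4 * m"
      using D by (auto simp: face_closed_def)
    ultimately have "opposite x = opposite y" using L_simps(2) by metis
    then show "x = y" using flag_maps(2) by metis
  qed
  moreover have "finite D" using D by (auto simp: face_closed_def intro: finite_subset)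
  moreover have "(\<lambda>f. L (opposite f)) ` D \<subseteq> D" using D by (auto simp: face_closed_def)
  ultimately have "(\<lambda>f. L (opposite f)) ` D = D" by (metis endo_inj_surj)
  then obtain g where g: "g \<in> D" "f = L (opposite g)" using True by blast
  moreover have "opposite g < 4 * m" using g D by (auto simp: face_closed_def)
  ultimately show ?thesis using L_simps(2) by simp
next
  case False
  then show ?thesis using D f by (auto simp: face_closed_def)
qed

text \<open>Both even flags of a twisted edge are in \<open>D\<close>, so all its four flags are in
  the union. On other edges \<open>edge_map T\<close> is \<open>opposite\<close>, which preserves
  the union.\<close>

lemma explored_edge_map:
  assumes D: "explored D T" and f: "f \<in> D \<union> opposite ` D"
  shows "edge_map T f \<in> D \<union> opposite ` D"
proof (cases "f div 4 \<in> T")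
  case True
  show ?thesis
  proof (cases "even f")
    case True
    then have "cross f \<in> D" using D \<open>f div 4 \<in> T\<close> by (simp add: explored_def)
    then show ?thesis using \<open>f div 4 \<in> T\<close> by (simp add: edge_map_def)
  next
    case False
    then have "flip f \<in> D" using D \<open>f div 4 \<in> T\<close> by (simp add: explored_def)
    then have "opposite (flip f) \<in> opposite ` D" by blast
    then show ?thesis using \<open>f div 4 \<in> T\<close> by (simp add: edge_map_def)
  qed
next
  case False
  then show ?thesis using f by (auto simp: edge_map_def)
qed

text \<open>The twist cuts the link between \<open>a\<close> and \<open>opposite a\<close>, but the
  rest of the cycle through it still joins its ends, by \<open>detour\<close>. The other side of the
  edge is not visited, so no other link among the visited flags changes.\<close>

lemma reach_twist:
  assumes D: "explored D T" and a: "a \<in> D" "cross a \<notin> D" and f: "f \<in> D \<union> opposite ` D"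
  shows "reach (insert (a div 4) T) f"
proof -
  let ?F = "D \<union> opposite ` D" and ?T = "insert (a div 4) T"
  have F: "g < 4 * m" if "g \<in> ?F" for g
    using D that by (auto simp: explored_def face_closed_def)
  have closed: "L g \<in> ?F" "edge_map T g \<in> ?F" if "g \<in> ?F" for g
    using face_closed_L explored_edge_map D that by (auto simp: explored_def)
  have aT: "a div 4 \<notin> T"
  proof
    assume "a div 4 \<in> T"
    moreover have "even (cross a)" using D a(1) by (auto simp: explored_def face_closed_def)
    ultimately show False using D a(2) by (simp add: explored_def)
  qed
  have other: "edge_map ?T g = edge_map T g" if "g \<in> ?F" "g \<noteq> a" "g \<noteq> opposite a" for g
  proof -
    have par: "even x" if "x \<in> D" for x
      using D that by (auto simp: explored_def face_closed_def)
    have "odd x" if "x \<in> opposite ` D" for x using par that by auto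
    moreover have "even (cross a)" using par[OF a(1)] by simp
    ultimately have "cross a \<notin> ?F" using a(2) by blast
    moreover have "flip a \<notin> ?F"
    proof
      assume "flip a \<in> ?F"
      then show False
      proof
        assume "flip a \<in> opposite ` D"
        then obtain x where "x \<in> D" "flip a = opposite x" by blast
        then have "cross a = x" by (metis flag_maps(2,5) flag_maps(1,4,6))
        then show False using a \<open>x \<in> D\<close> by simp
      qed (use par[of "flip a"] par[of a] a in auto)
    qed
    ultimately have "g div 4 \<noteq> a div 4" using that unfolding same_edge_flags by blast
    then show ?thesis by (simp add: edge_map_def)
  qed
  interpret free_involutions ?F L "edge_map T"
  proof
    show "finite ?F" using F by (intro finite_subset[of ?F "{..<4 * m}"]) auto
  qed (use closed F L_simps in auto)
  have aF: "a \<in> ?F" and Ra: "edge_map T a = opposite a"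
    using a aT by (auto simp: edge_map_def)
  have detour': "(opposite a, a) \<in> {(y, z). y \<in> ?F \<and> z \<in> ?F \<and> (z = L y \<or> z = edge_map ?T y)}\<^sup>*"
    using detour[OF aF] unfolding Ra
    by (rule rtrancl_mono[THEN subsetD, rotated]) (use other in auto)
  then have to_a: "(opposite a, a) \<in> (adj L (edge_map ?T))\<^sup>*"
    by (rule rtrancl_mono[THEN subsetD, rotated]) (auto simp: adj_def)
  \<comment> \<open>The restriction to \<open>?F\<close> matters here: \<open>L\<close> is known to
    be an involution on flags only.\<close>
  have "sym {(y, z). y \<in> ?F \<and> z \<in> ?F \<and> (z = L y \<or> z = edge_map ?T y)}"
    using L_L by (auto simp: sym_def)
  then have "(a, opposite a) \<in> {(y, z). y \<in> ?F \<and> z \<in> ?F \<and> (z = L y \<or> z = edge_map ?T y)}\<^sup>*"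
    using detour' sym_rtrancl by (metis (lifting) symD)
  then have from_a: "(a, opposite a) \<in> (adj L (edge_map ?T))\<^sup>*"
    by (rule rtrancl_mono[THEN subsetD, rotated]) (auto simp: adj_def)
  have "(0, f) \<in> (adj L (edge_map T))\<^sup>*" using D f by (auto simp: explored_def reach_def)
  then have "f \<in> ?F \<and> (0, f) \<in> (adj L (edge_map ?T))\<^sup>*"
  proof induction
    case base
    then show ?case using D by (simp add: explored_def)
  next
    case (step y z)
    then have y: "y \<in> ?F" and "z = L y \<or> z = edge_map T y" by (auto simp: adj_def)
    then have z: "z \<in> ?F" using closed by blast
    have "(y, z) \<in> (adj L (edge_map ?T))\<^sup>*"
    proof (cases "z = edge_map T y \<and> (y = a \<or> y = opposite a)")
      case True
      have "edge_map T (opposite a) = a" using Ra edge_map_simps(1)[of T a] by simp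
      with True show ?thesis using Ra to_a from_a by auto
    next
      case False
      then have "z = L y \<or> z = edge_map ?T y"
        using other[OF y] \<open>z = L y \<or> z = edge_map T y\<close> by auto
      then show ?thesis by (auto simp: adj_def intro!: r_into_rtrancl)
    qed
    with step.IH z show ?case by (meson rtrancl_trans)
  qed
  then show ?thesis by (simp add: reach_def)
qed

text \<open>The state while a face is traced: \<open>y\<close> is the flag where the trace started, \<open>f\<close> the current
  one.\<close>

definition tracing :: "nat \<Rightarrow> nat set \<Rightarrow> nat set \<Rightarrow> nat \<Rightarrow> bool" where
  "tracing y D T f \<longleftrightarrow> D \<subseteq> {g. even g \<and> g < 4 * m} \<and> even f \<and> f < 4 * m \<and>
     (\<forall>g\<in>D. L (opposite g) \<in> insert f D) \<and> (y \<in> D \<or> f = y) \<and> (0 \<in> D \<or> y = 0) \<and>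
     (\<forall>g. even g \<longrightarrow> g div 4 \<in> T \<longrightarrow> g \<in> insert y D) \<and>
     (\<forall>g. g div 4 \<in> T \<longrightarrow> reach T g) \<and>
     (\<forall>g\<in>D. reach T g \<and> reach T (opposite g)) \<and> reach T f"

section \<open>The invariant of the face search\<close>

lemma tracing_init: "0 < m \<Longrightarrow> tracing 0 {} {} 0"
  by (simp add: tracing_def reach_def)

text \<open>The trace follows the untwisted map, while reachability refers to the twisted one. They
  agree at an untwisted edge, and the flags of a twisted edge are all known to be reachable.\<close>

lemma tracing_step:
  assumes "tracing y D T f"
  shows "tracing y (insert f D) T (L (opposite f))"
proof -
  have "reach T (opposite f)"
  proof (cases "f div 4 \<in> T")
    case True
    then show ?thesis using assms flag_maps_div(2) unfolding tracing_def by metis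
  next
    case False
    then show ?thesis using assms reach_edge_map[of T f] by (simp add: tracing_def edge_map_def)
  qed
  then show ?thesis using assms reach_L L_simps(1,3)[of "opposite f"]
    unfolding tracing_def by auto
qed

text \<open>The current flag is the only successor that may be missing from \<open>D\<close>; once
  it is visited, \<open>D\<close> is closed.\<close>

lemma tracing_done: "tracing y D T f \<Longrightarrow> f \<in> D \<Longrightarrow> explored D T \<and> y \<in> D"
  unfolding tracing_def explored_def face_closed_def by auto

lemma tracing_card:
  assumes "tracing y D T f"
  shows "finite D" "card D \<le> 2 * m" "f \<notin> D \<Longrightarrow> card D < 2 * m"
proof -
  have sub: "insert f D \<subseteq> (\<lambda>i. 2 * i) ` {..<2 * m}"
  proof
    fix g assume "g \<in> insert f D"
    then have "even g" "g < 4 * m" using assms by (auto simp: tracing_def)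
    then show "g \<in> (\<lambda>i. 2 * i) ` {..<2 * m}" by (auto elim!: evenE)
  qed
  show fin: "finite D" using sub by (auto intro: finite_subset)
  have "card (insert f D) \<le> card ((\<lambda>i. 2 * i) ` {..<2 * m})"
    using sub by (intro card_mono) auto
  also have "\<dots> \<le> 2 * m" using card_image_le[of "{..<2 * m}" "\<lambda>i. 2 * i"] by simp
  finally show "card D \<le> 2 * m" "f \<notin> D \<Longrightarrow> card D < 2 * m"
    using fin by (auto simp: card_insert_if split: if_splits)
qed

text \<open>If the reverse direction \<open>cross a\<close> has been visited, the trace from it ends
  at once. Otherwise it lies on a new face, and the twist attaches this face to the reachable part
  before it is traced.\<close>

lemma tracing_start:
  assumes D: "explored D T" and a: "a \<in> D"
  defines "T' \<equiv> if cross a \<in> D then T else insert (a div 4) T"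
  shows "tracing (cross a) D T' (cross a)"
proof -
  have par: "even g" "g < 4 * m" if "g \<in> D" for g
    using D that by (auto simp: explored_def face_closed_def)
  have old: "reach T' f" if "f \<in> D \<union> opposite ` D" for f
    using reach_twist[OF D a _ that] D that unfolding T'_def by (auto simp: explored_def)
  have "reach T' (cross a)"
  proof (cases "cross a \<in> D")
    case False
    then show ?thesis using old[of a] a reach_edge_map[of T' a] by (simp add: edge_map_def T'_def)
  qed (use old in auto)
  moreover have "reach T' g" if "g div 4 \<in> T'" for g
  proof (cases "g div 4 \<in> T")
    case True
    show ?thesis
    proof (cases "even g")
      case True
      then show ?thesis using old D \<open>g div 4 \<in> T\<close> by (auto simp: explored_def)
    next
      case False
      then have "opposite g \<in> D" using D \<open>g div 4 \<in> T\<close> by (auto simp: explored_def)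
      then have "opposite (opposite g) \<in> opposite ` D" by blast
      then show ?thesis using old by simp
    qed
  next
    case False
    then have T': "T' = insert (a div 4) T" and "g div 4 = a div 4"
      using that by (auto simp: T'_def split: if_splits)
    then have "g \<in> {a, opposite a, cross a, flip a}" by (simp only: same_edge_flags)
    \<comment> \<open>The twist links \<open>a\<close> with \<open>cross a\<close> and
      \<open>opposite a\<close> with \<open>flip a\<close>, so all four flags of the edge become
      reachable.\<close>
    moreover have "edge_map T' (opposite a) = flip a" by (simp add: edge_map_def T')
    then have "reach T' (flip a)" using old[of "opposite a"] a reach_edge_map[of T' "opposite a"] by auto
    ultimately show ?thesis using old a \<open>reach T' (cross a)\<close> by auto
  qed
  moreover have "g \<in> insert (cross a) D" if "even g" "g div 4 \<in> T'" for g
  proof (cases "g div 4 \<in> T")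
    case True
    then show ?thesis using that D by (simp add: explored_def)
  next
    case False
    then have "g div 4 = a div 4" using that by (auto simp: T'_def split: if_splits)
    then have "g \<in> {a, opposite a, cross a, flip a}" by (simp only: same_edge_flags)
    then show ?thesis using that(1) par[OF a] a by auto
  qed
  ultimately show ?thesis
    using D a par old unfolding tracing_def explored_def face_closed_def by auto
qed

text \<open>Closure under \<open>cross\<close> and \<open>opposite\<close> gives closure under
  \<open>flip\<close>. With \<open>L\<close> this makes the visited flags contain all flags of a
  vertex if they contain one, and \<open>opposite\<close> passes this on to adjacent
  vertices.\<close>

lemma explored_all:
  assumes D: "explored D T" and cross: "\<And>a. a \<in> D \<Longrightarrow> cross a \<in> D"
    and conn: "\<And>f g. f < 4 * m \<Longrightarrow> g < 4 * m \<Longrightarrow>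
      (V (f div 2), V (g div 2)) \<in> {(V (h div 2), V (opposite h div 2)) | h. h < 4 * m}\<^sup>*"
    and f: "f < 4 * m"
  shows "reach T f"
proof -
  let ?F = "D \<union> opposite ` D"
  have DL: "L g \<in> ?F" if "g \<in> ?F" for g
    using face_closed_L D that by (auto simp: explored_def)
  have Dflip: "flip g \<in> ?F" if "g \<in> ?F" for g
    using that
  proof
    assume "g \<in> D"
    then have "opposite (cross g) \<in> opposite ` D" using cross by blast
    then show ?thesis by simp
  qed (use cross in auto)
  have same: "h \<in> ?F" if "g \<in> ?F" "(g, h) \<in> (adj L flip)\<^sup>*" for g h
    using that(2,1)
  proof induction
    case (step y z)
    then have "z = L y \<or> z = flip y" by (simp add: adj_def)
    then show ?case using step.IH step.prems DL Dflip by blast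
  qed
  have vertex: "h \<in> ?F" if "g \<in> ?F" "h < 4 * m" "V (g div 2) = V (h div 2)" for g h
  proof -
    have "g < 4 * m" using that D by (auto simp: explored_def face_closed_def)
    then have "(g, h) \<in> (adj L flip)\<^sup>*" using linked that by (simp add: linked_def)
    then show ?thesis using same that by blast
  qed
  have 0: "0 < 4 * m" "0 \<in> ?F" using D by (auto simp: explored_def face_closed_def)
  have "\<forall>g < 4 * m. V (g div 2) = v \<longrightarrow> g \<in> ?F"
    if "(V (0 div 2), v) \<in> {(V (h div 2), V (opposite h div 2)) | h. h < 4 * m}\<^sup>*" for v
    using that
  proof induction
    case base
    then show ?case using vertex[of 0] 0 by simp
  next
    case (step v w)
    then obtain h where h: "h < 4 * m" "V (h div 2) = v" "V (opposite h div 2) = w" by blast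
    then have "h \<in> ?F" using step.IH by blast
    then have "opposite h \<in> ?F" by auto
    then show ?case using vertex h by metis
  qed
  then have "f \<in> ?F" using conn[OF 0(1) f] f by blast
  then show ?thesis using D by (auto simp: explored_def)
qed

end

section \<open>Program verification with a time budget\<close>

definition wp ::
  "nat \<Rightarrow> (nat \<Rightarrow> nat \<Rightarrow> real) \<Rightarrow> com \<Rightarrow> (ram_state \<Rightarrow> nat \<Rightarrow> bool) \<Rightarrow> ram_state \<Rightarrow> nat \<Rightarrow> bool"
where
  "wp B q c Q s n \<longleftrightarrow> (\<exists>t s'. ram_exec B q c s t s' \<and> t \<le> n \<and> Q s' (n - t))"

lemma wp_mono:
  assumes "wp B q c Q s n" "\<And>s n. Q s n \<Longrightarrow> Q' s n"
  shows "wp B q c Q' s n"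
  using assms unfolding wp_def by blast

lemma wp_Skip: "wp B q Skip Q s n \<longleftrightarrow> 1 \<le> n \<and> Q s (n - 1)"
  unfolding wp_def
proof safe
  assume "1 \<le> n" "Q s (n - 1)"
  with ram_exec.Skip show "\<exists>t s'. ram_exec B q Skip s t s' \<and> t \<le> n \<and> Q s' (n - t)" by blast
qed (erule ram_exec_SkipE; simp)+

lemma wp_WAssign:
  "wp B q (WAssign A a b) Q s n \<longleftrightarrow> wfits B s a \<and> wfits B s b \<and> 1 + wtime a + wtime b \<le> n \<and>
     Q (wstore A (wval s a) (wval s b) s) (n - (1 + wtime a + wtime b))"
  unfolding wp_def
proof safe
  fix t s' assume "ram_exec B q (WAssign A a b) s t s'" and tn: "t \<le> n" "Q s' (n - t)"
  from this(1) show "wfits B s a" "wfits B s b" "1 + wtime a + wtime b \<le> n"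
    "Q (wstore A (wval s a) (wval s b) s) (n - (1 + wtime a + wtime b))"
    using tn by - (erule ram_exec_WAssignE; simp)+
next
  assume "wfits B s a" "wfits B s b" and n: "1 + wtime a + wtime b \<le> n"
    "Q (wstore A (wval s a) (wval s b) s) (n - (1 + wtime a + wtime b))"
  from ram_exec.WAssign[OF this(1,2)] n
  show "\<exists>t s'. ram_exec B q (WAssign A a b) s t s' \<and> t \<le> n \<and> Q s' (n - t)" by blast
qed

lemma wp_Seq: "wp B q (Seq c d) Q s n \<longleftrightarrow> wp B q c (wp B q d Q) s n"
  unfolding wp_def
proof safe
  fix t s' assume "ram_exec B q (Seq c d) s t s'" and tn: "t \<le> n" "Q s' (n - t)"
  then obtain t1 t2 s1 where "ram_exec B q c s t1 s1" "ram_exec B q d s1 t2 s'" "t = t1 + t2"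
    by (elim ram_exec_SeqE) blast
  then show "\<exists>t s'. ram_exec B q c s t s' \<and> t \<le> n \<and>
      (\<exists>ta s''. ram_exec B q d s' ta s'' \<and> ta \<le> n - t \<and> Q s'' (n - t - ta))"
    using tn by (intro exI[of _ t1] exI[of _ s1] conjI exI[of _ t2] exI[of _ s']) auto
next
  fix t1 t2 s1 s' assume "ram_exec B q c s t1 s1" "ram_exec B q d s1 t2 s'"
    "t1 \<le> n" "t2 \<le> n - t1" "Q s' (n - t1 - t2)"
  then show "\<exists>t s'. ram_exec B q (Seq c d) s t s' \<and> t \<le> n \<and> Q s' (n - t)"
    by (intro exI[of _ "t1 + t2"] exI[of _ s']) (auto intro: ram_exec.Seq)
qed

lemma wp_Branch:
  "wp B q (Branch b c d) Q s n \<longleftrightarrow> cfits B s b \<and> 1 + ctime b \<le> n \<and>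
     (if cval q s b then wp B q c Q s (n - (1 + ctime b)) else wp B q d Q s (n - (1 + ctime b)))"
  (is "?l \<longleftrightarrow> ?r")
proof
  assume ?l
  then obtain t s' where "ram_exec B q (Branch b c d) s t s'" and tn: "t \<le> n" "Q s' (n - t)"
    unfolding wp_def by blast
  from this(1) have "cfits B s b \<and> (\<exists>u. t = 1 + ctime b + u \<and>
      (if cval q s b then ram_exec B q c s u s' else ram_exec B q d s u s'))"
    by (rule ram_exec_BranchE) auto
  then obtain u where "cfits B s b" "t = 1 + ctime b + u"
    "if cval q s b then ram_exec B q c s u s' else ram_exec B q d s u s'" by blast
  moreover from this(2) tn have "1 + ctime b \<le> n" "u \<le> n - (1 + ctime b)"
    "Q s' (n - (1 + ctime b) - u)" by simp_all
  ultimately show ?r unfolding wp_def by (metis (full_types))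
next
  assume r: ?r
  show ?l
  proof (cases "cval q s b")
    case True
    with r obtain u s' where "ram_exec B q c s u s'" "u \<le> n - (1 + ctime b)"
      "Q s' (n - (1 + ctime b) - u)" unfolding wp_def by auto
    then show ?l unfolding wp_def using r True
      by (intro exI[of _ "1 + ctime b + u"] exI[of _ s']) (auto intro!: BranchTrue[simplified])
  next
    case False
    with r obtain u s' where "ram_exec B q d s u s'" "u \<le> n - (1 + ctime b)"
      "Q s' (n - (1 + ctime b) - u)" unfolding wp_def by auto
    then show ?l unfolding wp_def using r False
      by (intro exI[of _ "1 + ctime b + u"] exI[of _ s']) (auto intro!: BranchFalse[simplified])
  qed
qed

text \<open>The invariant speaks about the remaining time \<open>n\<close>, so that it bounds the running time, also
  an amortized one, and entails termination.\<close>

lemma wp_Loop: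
  assumes "I s n"
    and step: "\<And>s n. I s n \<Longrightarrow> cfits B s b \<and> 1 + ctime b \<le> n \<and>
      (if cval q s b then wp B q c I s (n - (1 + ctime b)) else Q s (n - (1 + ctime b)))"
  shows "wp B q (Loop b c) Q s n"
  using assms(1)
proof (induction n arbitrary: s rule: less_induct)
  case (less n)
  note I = step[OF less.prems]
  show ?case
  proof (cases "cval q s b")
    case True
    with I obtain u s' where u: "ram_exec B q c s u s'" "u \<le> n - (1 + ctime b)"
      "I s' (n - (1 + ctime b) - u)" unfolding wp_def by auto
    moreover from I have "n - (1 + ctime b) - u < n" by simp
    ultimately have "wp B q (Loop b c) Q s' (n - (1 + ctime b) - u)" using less.IH by blast
    then obtain v s'' where "ram_exec B q (Loop b c) s' v s''" "v \<le> n - (1 + ctime b) - u"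
      "Q s'' (n - (1 + ctime b) - u - v)" unfolding wp_def by blast
    then show ?thesis unfolding wp_def using I True u
      by (intro exI[of _ "1 + ctime b + u + v"] exI[of _ s'']) (auto intro!: LoopTrue[simplified])
  next
    case False
    then show ?thesis unfolding wp_def using I
      by (intro exI[of _ "1 + ctime b"] exI[of _ s]) (simp add: LoopFalse[simplified])
  qed
qed

lemmas wp_simps = wp_Skip wp_WAssign wp_Seq wp_Branch

lemma wmem_wstore [simp]:
  "wmem (wstore A i x s) = (wmem s)(A := (wmem s A)(i := x))"
  by (simp add: wstore_def)

abbreviation var :: "nat \<Rightarrow> wexp" where "var A \<equiv> WRead A (WConst 0)"
abbreviation add (infixl "\<oplus>" 65) where "a \<oplus> b \<equiv> WBin WPlus a b"
abbreviation sub (infixl "\<ominus>" 65) where "a \<ominus> b \<equiv> WBin WMinus a b"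
abbreviation mul (infixl "\<otimes>" 70) where "a \<otimes> b \<equiv> WBin WTimes a b"
abbreviation quo (infixl "\<oslash>" 70) where "a \<oslash> b \<equiv> WBin WDiv a b"
abbreviation rem (infixl "\<odot>" 70) where "a \<odot> b \<equiv> WBin WMod a b"
abbreviation seq (infixr ";;" 60) where "c ;; d \<equiv> Seq c d"

text \<open>Array 6 maps half-edges to vertices, array 7 maps a vertex to the successor of one of its
  half-edges (0 if it has none yet), array 8 is \<open>L\<close>, array 9 marks the visited even flags, array 10
  is the queue of these flags, and array 11 marks the twisted edges. Arrays 12 to 17 hold variables:
  15 and 16 are the ends of the queue, and 17 is the current flag.\<close>

definition build_step :: com where
  "build_step =
     Branch (WLess (var 12 \<odot> WConst 2) (WConst 1))
       (WAssign 6 (var 12) (WRead 2 (var 12 \<oslash> WConst 2)))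
       (WAssign 6 (var 12) (WRead 3 (var 12 \<oslash> WConst 2))) ;;
     Branch (WLess (WRead 7 (WRead 6 (var 12))) (WConst 1))
       (WAssign 7 (WRead 6 (var 12)) (var 12 \<oplus> WConst 1) ;;
        WAssign 8 (WConst 2 \<otimes> var 12) (WConst 2 \<otimes> var 12 \<oplus> WConst 1) ;;
        WAssign 8 (WConst 2 \<otimes> var 12 \<oplus> WConst 1) (WConst 2 \<otimes> var 12))
       (WAssign 13 (WConst 0) (WConst 2 \<otimes> (WRead 7 (WRead 6 (var 12)) \<ominus> WConst 1) \<oplus> WConst 1) ;;
        WAssign 14 (WConst 0) (WRead 8 (var 13)) ;;
        WAssign 8 (var 13) (WConst 2 \<otimes> var 12) ;;
        WAssign 8 (WConst 2 \<otimes> var 12) (var 13) ;;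
        WAssign 8 (WConst 2 \<otimes> var 12 \<oplus> WConst 1) (var 14) ;;
        WAssign 8 (var 14) (WConst 2 \<otimes> var 12 \<oplus> WConst 1)) ;;
     WAssign 12 (WConst 0) (var 12 \<oplus> WConst 1)"

definition build_links :: com where
  "build_links = Loop (WLess (var 12) (WConst 2 \<otimes> var 1)) build_step"

definition headed :: "nat \<Rightarrow> (nat \<Rightarrow> 'v) \<Rightarrow> ('v \<Rightarrow> nat) \<Rightarrow> bool" where
  "headed k V H \<longleftrightarrow> (\<forall>v. if H v = 0 then \<forall>i<k. V i \<noteq> v else H v \<le> k \<and> V (H v - 1) = v)"

lemma headed_first:
  assumes "headed k V H"
  shows "headed (Suc k) V (H(V k := Suc k))"
  unfolding headed_def
proof
  fix v
  show "if (H(V k := Suc k)) v = 0 then \<forall>i<Suc k. V i \<noteq> v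
    else (H(V k := Suc k)) v \<le> Suc k \<and> V ((H(V k := Suc k)) v - 1) = v"
    using assms[unfolded headed_def, rule_format, of v]
    by (cases "v = V k") (auto simp: less_Suc_eq split: if_splits)
qed

lemma headed_after:
  assumes "headed k V H" "H (V k) \<noteq> 0"
  shows "headed (Suc k) V H"
  unfolding headed_def
proof
  fix v
  show "if H v = 0 then \<forall>i<Suc k. V i \<noteq> v else H v \<le> Suc k \<and> V (H v - 1) = v"
    using assms(1)[unfolded headed_def, rule_format, of v] assms(2)
    by (cases "v = V k") (auto simp: less_Suc_eq split: if_splits)
qed

locale ram_input =
  fixes B :: nat and q :: "nat \<Rightarrow> nat \<Rightarrow> real" and m :: nat and U W V :: "nat \<Rightarrow> nat"
  assumes B: "8 * m + 8 \<le> B" and V_le: "i < 2 * m \<Longrightarrow> V i \<le> B"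
    and V_eq: "V i = (if even i then U (i div 2) else W (i div 2))"
begin

text \<open>The last conjunct preserves the zeroed memory for the later phases.\<close>

definition building :: "ram_state \<Rightarrow> bool" where
  "building s \<longleftrightarrow> wmem s 1 0 = m \<and> wmem s 2 = U \<and> wmem s 3 = W \<and> wmem s 12 0 \<le> 2 * m \<and>
     (\<forall>i < wmem s 12 0. wmem s 6 i = V i) \<and> headed (wmem s 12 0) V (wmem s 7) \<and>
     linked (wmem s 12 0) V (wmem s 8) \<and>
     (\<forall>A\<in>{4, 9, 10, 11, 15, 16, 17}. wmem s A = (\<lambda>_. 0))"

text \<open>Each remaining half-edge holds a budget of 150, of which 10 is set aside for the next
  loop test.\<close>

lemma build_step:
  assumes inv: "building s" and less: "wmem s 12 0 < 2 * m"
    and n: "150 * (2 * m - wmem s 12 0) + r \<le> n"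
  shows "wp B q build_step (\<lambda>s n. building s \<and> 150 * (2 * m - wmem s 12 0) + r + 10 \<le> n) s n"
proof -
  define h E H L where "h = wmem s 12 0" and "E = wmem s 6" and "H = wmem s 7" and "L = wmem s 8"
  have s: "wmem s (Suc 0) 0 = m" "wmem s 2 = U" "wmem s 3 = W" "wmem s 12 0 = h" "wmem s 6 = E"
    "wmem s 7 = H" "wmem s 8 = L"
    using inv by (simp_all add: building_def h_def E_def H_def L_def)
  have zero: "wmem s 4 = (\<lambda>_. 0)" "wmem s 9 = (\<lambda>_. 0)" "wmem s 10 = (\<lambda>_. 0)"
    "wmem s 11 = (\<lambda>_. 0)" "wmem s 15 = (\<lambda>_. 0)" "wmem s 16 = (\<lambda>_. 0)" "wmem s 17 = (\<lambda>_. 0)"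
    using inv by (simp_all add: building_def)
  have h: "h < 2 * m" "\<And>i. i < h \<Longrightarrow> E i = V i" "headed h V H" "linked h V L"
    using inv less unfolding building_def by (simp_all add: s)
  have n: "150 * (2 * m - Suc h) + 150 + r \<le> n"
    using n h(1) by (simp add: s)
  note Vh = V_le[OF h(1)]
  have E: "(E(h := V h)) i = V i" if "i < Suc h" for i
    using h(2) that by (auto simp: less_Suc_eq)
  have half: "h div 2 \<le> B" using h(1) B by linarith
  show ?thesis
  proof (cases "H (V h) = 0")
    case H: True
    have new: "headed (Suc h) V (H(V h := Suc h))" "linked (Suc h) V (L(2 * h := Suc (2 * h), Suc (2 * h) := 2 * h))"
      using headed_first[OF h(3)] linked_insert_first[OF h(4)] h(3) H
      by (simp_all add: headed_def)
    show ?thesis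
    proof (cases "even h")
      case True
      then have V: "U (h div 2) = V h" "h mod 2 = 0" by (simp_all add: V_eq odd_iff_mod_2_eq_one)
      show ?thesis
        using h B Vh half n H zero new E
        by (simp add: build_step_def wp_simps s V building_def; intro conjI; linarith)
    next
      case False
      have V: "W (h div 2) = V h" using False by (simp add: V_eq)
      have mod: "h mod 2 = Suc 0" using False by (simp add: odd_iff_mod_2_eq_one)
      show ?thesis
        using h B Vh half n H zero new E
        by (simp add: build_step_def wp_simps s V mod building_def; intro conjI; linarith)
    qed
  next
    case H: False
    \<comment> \<open>The odd side of the half-edge recorded for the vertex, whose number is stored
      plus one.\<close>
    define p where "p = Suc (2 * (H (V h) - Suc 0))"
    have j': "H (V h) \<le> h" "V (H (V h) - 1) = V h"
      using h(3)[unfolded headed_def, rule_format, of "V h"] H by simp_all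
    then have j: "H (V h) - 1 < h" "V (H (V h) - 1) = V h" "H (V h) \<le> h" using H by linarith+
    have p: "p < 2 * h" using j(1) unfolding p_def by (simp; linarith)
    have Lp: "L p < 2 * h" using h(4) p by (auto simp: linked_def)
    have new: "headed (Suc h) V H"
      "linked (Suc h) V (L(p := 2 * h, 2 * h := p, Suc (2 * h) := L p, L p := Suc (2 * h)))"
      using headed_after[OF h(3) H] linked_insert_after[OF h(4) j(1,2)] by (simp_all add: p_def)
    show ?thesis
    proof (cases "even h")
      case True
      then have V: "U (h div 2) = V h" "h mod 2 = 0" by (simp_all add: V_eq odd_iff_mod_2_eq_one)
      show ?thesis
        using h B Vh half n H zero new E p Lp j
        by (simp add: build_step_def wp_simps s V building_def flip: p_def; intro conjI; linarith)
    next
      case False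
      have V: "W (h div 2) = V h" using False by (simp add: V_eq)
      have mod: "h mod 2 = Suc 0" using False by (simp add: odd_iff_mod_2_eq_one)
      show ?thesis
        using h B Vh half n H zero new E p Lp j
        by (simp add: build_step_def wp_simps s V mod building_def flip: p_def; intro conjI; linarith)
    qed
  qed
qed

lemma build_links:
  assumes "building s" "150 * (2 * m - wmem s 12 0) + r + 10 \<le> n"
  shows "wp B q build_links (\<lambda>s n. building s \<and> wmem s 12 0 = 2 * m \<and> r \<le> n) s n"
  unfolding build_links_def
proof (rule wp_Loop[where I = "\<lambda>s n. building s \<and> 150 * (2 * m - wmem s 12 0) + r + 10 \<le> n"])
  fix s n assume inv: "building s \<and> 150 * (2 * m - wmem s 12 0) + r + 10 \<le> n"
  let ?b = "WLess (var 12) (WConst 2 \<otimes> var 1)"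
  have "cval q s ?b \<longleftrightarrow> wmem s 12 0 < 2 * m" "cfits B s ?b" "1 + ctime ?b \<le> 10"
    "\<not> wmem s 12 0 < 2 * m \<Longrightarrow> wmem s 12 0 = 2 * m"
    using inv B by (auto simp: building_def)
  moreover from this inv have "150 * (2 * m - wmem s 12 0) + r \<le> n - (1 + ctime ?b)" by linarith
  ultimately show "cfits B s ?b \<and> 1 + ctime ?b \<le> n \<and>
     (if cval q s ?b
      then wp B q build_step (\<lambda>s n. building s \<and> 150 * (2 * m - wmem s 12 0) + r + 10 \<le> n) s (n - (1 + ctime ?b))
      else building s \<and> wmem s 12 0 = 2 * m \<and> r \<le> n - (1 + ctime ?b))"
    using build_step[of s r "n - (1 + ctime ?b)"] inv
    by (simp del: ctime.simps cval.simps cfits.simps)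
qed (use assms in simp)

end

section \<open>Searching the faces and emitting the walk\<close>

definition opposite_exp :: "wexp \<Rightarrow> wexp" where
  "opposite_exp a = a \<oplus> WConst 3 \<ominus> WConst 2 \<otimes> (a \<odot> WConst 4)"

definition cross_exp :: "wexp \<Rightarrow> wexp" where
  "cross_exp a = a \<oplus> WConst 2 \<ominus> WConst 4 \<otimes> (a \<odot> WConst 4 \<oslash> WConst 2)"

lemma wval_flag_exp [simp]:
  "wval s (opposite_exp a) = opposite (wval s a)" "wval s (cross_exp a) = cross (wval s a)"
  unfolding opposite_exp_def cross_exp_def opposite_def cross_def
  by (simp_all only: wval.simps wop_val.simps)

lemma wtime_flag_exp [simp]:
  "wtime (opposite_exp a) = 2 * wtime a + 7" "wtime (cross_exp a) = 2 * wtime a + 9"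
  by (simp_all add: opposite_exp_def cross_exp_def)

text \<open>For a flag \<open>f\<close>, every intermediate result is at most \<open>f + 3\<close>
  or at most 6, the largest value of \<open>2 * (f mod 4)\<close>.\<close>

lemma wfits_flag_exp [simp]:
  assumes "wfits B s a" "wval s a + 6 \<le> B"
  shows "wfits B s (opposite_exp a)" "wfits B s (cross_exp a)"
proof -
  have "wval s a mod 4 \<le> 3" "wval s a mod 4 div 2 \<le> 1" by linarith+
  with assms show "wfits B s (opposite_exp a)" "wfits B s (cross_exp a)"
    unfolding opposite_exp_def cross_exp_def wfits.simps wval.simps wop_val.simps
    by (intro conjI; linarith)+
qed

definition trace_step :: com where
  "trace_step =
     WAssign 9 (var 17) (WConst 1) ;;
     WAssign 10 (var 16) (var 17) ;;
     WAssign 16 (WConst 0) (var 16 \<oplus> WConst 1) ;;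
     WAssign 17 (WConst 0) (WRead 8 (opposite_exp (var 17)))"

definition trace :: com where
  "trace = Loop (WLess (WRead 9 (var 17)) (WConst 1)) trace_step"

definition explore_step :: com where
  "explore_step =
     WAssign 17 (WConst 0) (cross_exp (WRead 10 (var 15))) ;;
     Branch (WLess (WRead 9 (var 17)) (WConst 1)) (WAssign 11 (var 17 \<oslash> WConst 4) (WConst 1)) Skip ;;
     trace ;;
     WAssign 15 (WConst 0) (var 15 \<oplus> WConst 1)"

definition explore :: com where
  "explore = trace ;; Loop (WLess (var 15) (var 16)) explore_step"

definition emit_step :: com where
  "emit_step =
     WAssign 5 (var 4) (WRead 6 (var 17 \<oslash> WConst 2)) ;;
     Branch (WLess (WRead 11 (var 17 \<oslash> WConst 4)) (WConst 1))
       (WAssign 17 (WConst 0) (WRead 8 (opposite_exp (var 17))))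
       (WAssign 17 (WConst 0) (WRead 8 (cross_exp (var 17)))) ;;
     WAssign 4 (WConst 0) (var 4 \<oplus> WConst 1)"

definition emit :: com where
  "emit = WAssign 17 (WConst 0) (WConst 0) ;;
     Loop (WLess (var 4) (WConst 2 \<otimes> var 1)) emit_step"

text \<open>Reads the marker arrays 9 and 11 as the sets \<open>D\<close> and \<open>T\<close> of
  the search.\<close>

definition support :: "(nat \<Rightarrow> nat) \<Rightarrow> nat set" where
  "support a = {i. a i \<noteq> 0}"

lemma support_upd [simp]: "x \<noteq> 0 \<Longrightarrow> support (a(i := x)) = insert i (support a)"
  by (auto simp: support_def)

lemma mem_support [simp]: "i \<in> support a \<longleftrightarrow> 0 < a i"
  by (simp add: support_def)

text \<open>Flags are queued on their first visit, so the queue enumerates the visited flags without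
  repetition.\<close>

lemma bij_betw_push:
  assumes "bij_betw Q {..<k} D" "x \<notin> D"
  shows "bij_betw (Q(k := x)) {..<Suc k} (insert x D)"
proof -
  have "bij_betw (Q(k := x)) {..<k} D"
    using assms(1) by (rule bij_betw_cong[THEN iffD1, rotated]) simp
  then have "bij_betw (Q(k := x)) ({..<k} \<union> {k}) (D \<union> {x})"
    by (rule bij_betw_combine) (use assms(2) in auto)
  then show ?thesis by (simp add: lessThan_Suc Un_commute insert_is_Un[symmetric])
qed

locale ram_links = link_map m V L
  for m :: nat and V :: "nat \<Rightarrow> nat" and L +
  fixes B :: nat and q :: "nat \<Rightarrow> nat \<Rightarrow> real" and X :: "nat \<Rightarrow> nat"
  assumes B: "32 * m \<le> B" and m: "2 \<le> m"
    and X_le: "i < 2 * m \<Longrightarrow> X i \<le> B"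
begin

definition frame :: "ram_state \<Rightarrow> bool" where
  "frame s \<longleftrightarrow> wmem s 1 0 = m \<and> wmem s 4 0 = 0 \<and> wmem s 6 = X \<and> wmem s 8 = L \<and>
     wmem s 15 0 \<le> wmem s 16 0 \<and> (\<forall>i. wmem s 9 i \<le> 1) \<and> (\<forall>i. wmem s 11 i \<le> 1) \<and>
     bij_betw (wmem s 10) {..<wmem s 16 0} (support (wmem s 9))"

text \<open>\<open>k\<close> is the number of queue entries whose reverse direction will have been visited when the
  trace is complete.\<close>

definition tracing_state :: "nat \<Rightarrow> nat \<Rightarrow> nat set \<Rightarrow> nat \<Rightarrow> ram_state \<Rightarrow> bool" where
  "tracing_state y k T j s \<longleftrightarrow> frame s \<and> wmem s 15 0 = j \<and> k \<le> wmem s 16 0 \<and> support (wmem s 11) = T \<and>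
     (\<forall>i<k. cross (wmem s 10 i) \<in> insert y (support (wmem s 9))) \<and>
     tracing y (support (wmem s 9)) T (wmem s 17 0)"

lemma tracing_queue_le:
  assumes "tracing_state y k T j s"
  shows "wmem s 16 0 \<le> 2 * m"
    and "wmem s 9 (wmem s 17 0) = 0 \<Longrightarrow> wmem s 16 0 < 2 * m"
proof -
  have t: "tracing y (support (wmem s 9)) T (wmem s 17 0)"
    and b: "bij_betw (wmem s 10) {..<wmem s 16 0} (support (wmem s 9))"
    using assms by (simp_all add: tracing_state_def frame_def)
  have "card (support (wmem s 9)) = wmem s 16 0" using bij_betw_same_card[OF b] by simp
  then show "wmem s 16 0 \<le> 2 * m" "wmem s 9 (wmem s 17 0) = 0 \<Longrightarrow> wmem s 16 0 < 2 * m"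
    using tracing_card(2,3)[OF t] by auto
qed

lemma trace_step:
  assumes inv: "tracing_state y k T j s" and new: "wmem s 9 (wmem s 17 0) = 0"
    and n: "60 * (2 * m - wmem s 16 0) + r \<le> n"
  shows "wp B q trace_step
     (\<lambda>s n. tracing_state y k T j s \<and> 60 * (2 * m - wmem s 16 0) + 10 + r \<le> n) s n"
proof -
  define f D Q where "f = wmem s 17 0" and "D = wmem s 9" and "Q = wmem s 10"
  have s: "wmem s (Suc 0) 0 = m" "wmem s 4 0 = 0" "wmem s 6 = X" "wmem s 8 = L" "wmem s 15 0 = j"
    "wmem s 17 0 = f" "wmem s 9 = D" "wmem s 10 = Q" "support (wmem s 11) = T"
    using inv by (simp_all add: tracing_state_def frame_def f_def D_def Q_def)
  have inv': "j \<le> wmem s 16 0" "k \<le> wmem s 16 0" "\<And>i. D i \<le> 1" "\<And>i. wmem s 11 i \<le> 1"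
    "bij_betw Q {..<wmem s 16 0} (support D)" "\<And>i. i < k \<Longrightarrow> cross (Q i) \<in> insert y (support D)"
    "tracing y (support D) T f"
    using inv by (simp_all add: tracing_state_def frame_def s(1-8))
  have f: "f < 4 * m" "opposite f < 4 * m" "L (opposite f) < 4 * m" "f \<notin> support D"
    using inv'(7) L_simps(1)[of "opposite f"] new by (auto simp: tracing_def s)
  have qt: "wmem s 16 0 < 2 * m" using tracing_queue_le(2)[OF inv] new by simp
  have n': "60 * (2 * m - Suc (wmem s 16 0)) + 60 + r \<le> n" using qt n by simp
  have push: "bij_betw (Q(wmem s 16 0 := f)) {..<Suc (wmem s 16 0)} (insert f (support D))"
    using bij_betw_push[OF inv'(5) f(4)] .
  have step: "tracing y (insert f (support D)) T (L (opposite f))"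
    using tracing_step[OF inv'(7)] .
  have cr: "cross ((Q(wmem s 16 0 := f)) i) \<in> insert y (insert f (support D))" if "i < k" for i
    using inv'(2) inv'(6)[OF that] that by auto
  have fit: "f + 6 \<le> B" "L (opposite f) \<le> B" "Suc (wmem s 16 0) \<le> B" "1 \<le> B"
    using f qt B m by linarith+
  have tracing_state': "tracing_state y k T j (wstore 17 0 (L (opposite f)) (wstore 16 0 (Suc (wmem s 16 0))
      (wstore 10 (wmem s 16 0) f (wstore 9 f 1 s))))"
    unfolding tracing_state_def frame_def
    using inv' push step cr by (auto simp: s le_SucI simp del: mem_support)
  then show ?thesis
    using fit n' by (simp add: trace_step_def wp_simps s; intro conjI; linarith)
qed

text \<open>The potential \<open>60 * (2 * m - wmem s 16 0)\<close> drops with each queued flag. The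
  flags visited by a trace thus pay for it, up to the 10 for its last loop test.\<close>

lemma trace:
  assumes inv: "tracing_state y k T j s" and n: "60 * (2 * m - wmem s 16 0) + 10 + r \<le> n"
  shows "wp B q trace (\<lambda>s n. frame s \<and> wmem s 15 0 = j \<and> k \<le> wmem s 16 0 \<and>
     explored (support (wmem s 9)) (support (wmem s 11)) \<and>
     (\<forall>i<k. cross (wmem s 10 i) \<in> support (wmem s 9)) \<and>
     60 * (2 * m - wmem s 16 0) + r \<le> n) s n"
  unfolding trace_def
proof (rule wp_Loop[where I = "\<lambda>s n. tracing_state y k T j s \<and> 60 * (2 * m - wmem s 16 0) + 10 + r \<le> n"])
  let ?b = "WLess (WRead 9 (var 17)) (WConst 1)"
  fix s n assume I: "tracing_state y k T j s \<and> 60 * (2 * m - wmem s 16 0) + 10 + r \<le> n"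
  then have tr: "tracing y (support (wmem s 9)) T (wmem s 17 0)" and T: "support (wmem s 11) = T"
    and fr: "frame s"
    and cr: "\<forall>i<k. cross (wmem s 10 i) \<in> insert y (support (wmem s 9))" "wmem s 15 0 = j" "k \<le> wmem s 16 0"
    by (simp_all add: tracing_state_def)
  have b: "cval q s ?b \<longleftrightarrow> wmem s 9 (wmem s 17 0) = 0" "1 + ctime ?b \<le> 10" by simp_all
  have "wmem s 9 (wmem s 17 0) \<le> 1" using fr unfolding frame_def by blast
  moreover have "wmem s 17 0 < 4 * m" using tr by (simp add: tracing_def)
  ultimately have fits: "cfits B s ?b" using B m by simp
  have t: "60 * (2 * m - wmem s 16 0) + r \<le> n - (1 + ctime ?b)" using I b(2) by linarith
  have "frame s \<and> wmem s 15 0 = j \<and> k \<le> wmem s 16 0 \<and> explored (support (wmem s 9)) (support (wmem s 11)) \<and>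
     (\<forall>i<k. cross (wmem s 10 i) \<in> support (wmem s 9))" if "wmem s 9 (wmem s 17 0) \<noteq> 0"
    using tracing_done[OF tr] that cr fr by (auto simp: T insert_absorb)
  then show "cfits B s ?b \<and> 1 + ctime ?b \<le> n \<and>
     (if cval q s ?b then wp B q trace_step
        (\<lambda>s n. tracing_state y k T j s \<and> 60 * (2 * m - wmem s 16 0) + 10 + r \<le> n) s (n - (1 + ctime ?b))
      else frame s \<and> wmem s 15 0 = j \<and> k \<le> wmem s 16 0 \<and> explored (support (wmem s 9)) (support (wmem s 11)) \<and>
        (\<forall>i<k. cross (wmem s 10 i) \<in> support (wmem s 9)) \<and>
        60 * (2 * m - wmem s 16 0) + r \<le> n - (1 + ctime ?b))"
    using b fits t I trace_step[of y k T j s r "n - (1 + ctime ?b)"]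
    by (simp del: ctime.simps cval.simps cfits.simps)
qed (use assms in simp)

lemma explore_step:
  assumes fr: "frame s" and ex: "explored (support (wmem s 9)) (support (wmem s 11))"
    and done_: "\<forall>i<wmem s 15 0. cross (wmem s 10 i) \<in> support (wmem s 9)"
    and less: "wmem s 15 0 < wmem s 16 0"
    and n: "60 * (2 * m - wmem s 16 0) + 60 + r \<le> n"
  shows "wp B q explore_step (\<lambda>s' n. frame s' \<and> wmem s' 15 0 = Suc (wmem s 15 0) \<and>
     explored (support (wmem s' 9)) (support (wmem s' 11)) \<and>
     (\<forall>i<wmem s' 15 0. cross (wmem s' 10 i) \<in> support (wmem s' 9)) \<and>
     60 * (2 * m - wmem s' 16 0) + r \<le> n) s n"
proof -
  define j where "j = wmem s 15 0"
  define a where "a = wmem s 10 j"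
  have a: "a \<in> support (wmem s 9)"
    using fr less unfolding frame_def a_def j_def by (meson bij_betwE lessThan_iff)
  then have a4: "a < 4 * m"
    using ex by (auto simp: explored_def face_closed_def simp del: mem_support)
  define y where "y = cross a"
  have y4: "y < 4 * m" using a4 by (simp add: y_def)
  define T where "T = (if wmem s 9 y = 0 then insert (a div 4) (support (wmem s 11))
    else support (wmem s 11))"
  have start: "tracing y (support (wmem s 9)) T y"
    using tracing_start[OF ex a] by (auto simp: T_def y_def)
  have fr': "wmem s (Suc 0) 0 = m" "wmem s 4 0 = 0" "wmem s 6 = X" "wmem s 8 = L"
     "wmem s 15 0 \<le> wmem s 16 0" "\<And>i. wmem s 9 i \<le> Suc 0" "\<And>i. wmem s 11 i \<le> Suc 0"
     "bij_betw (wmem s 10) {..<wmem s 16 0} (support (wmem s 9))"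
    using fr by (simp_all add: frame_def)
  have y_div: "y div 4 = a div 4" by (simp add: y_def)
  define s1 where "s1 = wstore 17 0 y s"
  define s2 where "s2 = (if wmem s 9 y = 0 then wstore 11 (y div 4) 1 s1 else s1)"
  \<comment> \<open>Entry \<open>j\<close> may be counted already, since its reverse direction
    \<open>y\<close> is the start of the trace.\<close>
  have "cross (wmem s 10 i) \<in> insert y (support (wmem s 9))" if "i < Suc j" for i
    using that done_ unfolding less_Suc_eq j_def y_def a_def by blast
  then have s2: "tracing_state y (Suc j) T j s2"
    using fr' less start y_div
    by (auto simp: tracing_state_def frame_def s2_def s1_def T_def j_def simp del: mem_support)
  have mem: "wmem s2 16 0 = wmem s 16 0" by (simp add: s2_def s1_def)
  have "wmem s 16 0 \<le> 2 * m" using tracing_queue_le(1)[OF s2] mem by simp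
  then have fit: "j < B" "a + 6 \<le> B" "y + 6 \<le> B" "y div 4 \<le> B" "1 \<le> B"
    using less a4 y4 B m unfolding j_def by linarith+
  have fit9: "wmem s 9 y \<le> B" using fr'(6)[of y] fit by linarith
  let ?Q = "\<lambda>s' n. frame s' \<and> wmem s' 15 0 = Suc j \<and> explored (support (wmem s' 9)) (support (wmem s' 11)) \<and>
     (\<forall>i<wmem s' 15 0. cross (wmem s' 10 i) \<in> support (wmem s' 9)) \<and>
     60 * (2 * m - wmem s' 16 0) + r \<le> n"
  have rest: "wp B q (trace ;; WAssign 15 (WConst 0) (var 15 \<oplus> WConst 1)) ?Q s2 n'"
    if "60 * (2 * m - wmem s 16 0) + 20 + r \<le> n'" for n'
    unfolding wp_Seq
  proof (rule wp_mono[OF trace[OF s2, of "r + 10"]])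
    show "60 * (2 * m - wmem s2 16 0) + 10 + (r + 10) \<le> n'" using that mem by simp
    fix s' n' assume "frame s' \<and> wmem s' 15 0 = j \<and> Suc j \<le> wmem s' 16 0 \<and>
      explored (support (wmem s' 9)) (support (wmem s' 11)) \<and>
      (\<forall>i<Suc j. cross (wmem s' 10 i) \<in> support (wmem s' 9)) \<and>
      60 * (2 * m - wmem s' 16 0) + (r + 10) \<le> n'"
    then show "wp B q (WAssign 15 (WConst 0) (var 15 \<oplus> WConst 1)) ?Q s' n'"
      using fit by (simp add: wp_simps frame_def del: mem_support; linarith)
  qed
  have "wp B q explore_step ?Q s n"
  \<comment> \<open>The time before \<open>trace\<close> is 29 if the edge gets marked as twisted,
    and 24 if not.\<close>
  proof (cases "wmem s 9 y = 0")
    case True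
    then have "s2 = wstore 11 (y div 4) 1 (wstore 17 0 y s)" by (simp add: s2_def s1_def)
    with rest[of "n - 29"] n show ?thesis
      using True fit fit9 by (simp add: explore_step_def wp_simps flip: j_def a_def y_def; linarith)
  next
    case False
    then have "s2 = wstore 17 0 y s" by (simp add: s2_def s1_def)
    with rest[of "n - 24"] n show ?thesis
      using False fit fit9 by (simp add: explore_step_def wp_simps flip: j_def a_def y_def; linarith)
  qed
  then show ?thesis by (simp add: j_def)
qed

text \<open>A flag pays 60 when it enters the queue and 70 when it leaves. For \<open>2 * m\<close>
  even flags this is \<open>260 * m\<close>, within the \<open>300 * m\<close> provided.\<close>

lemma explore:
  assumes fr: "frame s" and zero: "wmem s 9 = (\<lambda>_. 0)" "wmem s 11 = (\<lambda>_. 0)"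
      "wmem s 15 0 = 0" "wmem s 16 0 = 0" "wmem s 17 0 = 0"
    and n: "300 * m + 20 + r \<le> n"
  shows "wp B q explore (\<lambda>s n. frame s \<and> explored (support (wmem s 9)) (support (wmem s 11)) \<and>
     (\<forall>g\<in>support (wmem s 9). cross g \<in> support (wmem s 9)) \<and> r \<le> n) s n"
proof -
  let ?post = "\<lambda>s n. frame s \<and> explored (support (wmem s 9)) (support (wmem s 11)) \<and>
     (\<forall>g\<in>support (wmem s 9). cross g \<in> support (wmem s 9)) \<and> r \<le> n"
  let ?I = "\<lambda>s n. frame s \<and> explored (support (wmem s 9)) (support (wmem s 11)) \<and>
     (\<forall>i<wmem s 15 0. cross (wmem s 10 i) \<in> support (wmem s 9)) \<and>
     60 * (2 * m - wmem s 16 0) + (70 * (2 * m - wmem s 15 0) + 10 + r) \<le> n"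
  let ?b = "WLess (var 15) (var 16)"
  have start: "tracing_state 0 0 {} 0 s"
    using fr zero tracing_init m by (simp add: tracing_state_def support_def)
  have loop: "wp B q (Loop ?b explore_step) ?post s n" if "?I s n" for s n
    using that
  proof (rule wp_Loop[where I = ?I])
    fix s n assume I: "?I s n"
    then have b: "bij_betw (wmem s 10) {..<wmem s 16 0} (support (wmem s 9))"
      and le: "wmem s 15 0 \<le> wmem s 16 0"
      and ex: "explored (support (wmem s 9)) (support (wmem s 11))"
      by (simp_all add: frame_def)
    \<comment> \<open>The bound of \<open>tracing_card\<close> is transferred by considering a trace
      that could be started now.\<close>
    have "0 \<in> support (wmem s 9)" using ex by (simp add: explored_def)
    then have "card (support (wmem s 9)) \<le> 2 * m" using tracing_card(2)[OF tracing_start[OF ex]] by blast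
    then have qt: "wmem s 16 0 \<le> 2 * m" using bij_betw_same_card[OF b] by simp
    have c: "cval q s ?b \<longleftrightarrow> wmem s 15 0 < wmem s 16 0" "1 + ctime ?b = 6" by simp_all
    have fits: "cfits B s ?b" using qt le B m by simp
    have post: "\<forall>g\<in>support (wmem s 9). cross g \<in> support (wmem s 9)" if "\<not> wmem s 15 0 < wmem s 16 0"
    proof
      fix g assume "g \<in> support (wmem s 9)"
      then obtain i where "i < wmem s 16 0" "g = wmem s 10 i"
        using b by (metis bij_betw_imp_surj_on imageE lessThan_iff)
      then show "cross g \<in> support (wmem s 9)" using I that by simp
    qed
    have n: "6 \<le> n" "r \<le> n - 6" using I by linarith+
    have body: "wp B q explore_step ?I s (n - 6)" if less: "wmem s 15 0 < wmem s 16 0"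
    proof (rule wp_mono[OF explore_step[OF _ ex _ less, of "70 * (2 * m - Suc (wmem s 15 0)) + 10 + r"]])
      show "60 * (2 * m - wmem s 16 0) + 60 + (70 * (2 * m - Suc (wmem s 15 0)) + 10 + r) \<le> n - 6"
        using I less qt by linarith
    qed (use I in auto)
    show "cfits B s ?b \<and> 1 + ctime ?b \<le> n \<and>
      (if cval q s ?b then wp B q explore_step ?I s (n - (1 + ctime ?b)) else ?post s (n - (1 + ctime ?b)))"
      unfolding c using fits n post body I ex by auto
  qed
  show ?thesis
    unfolding explore_def wp_Seq
  proof (rule wp_mono[OF trace[OF start, of "140 * m + 10 + r"]])
    show "60 * (2 * m - wmem s 16 0) + 10 + (140 * m + 10 + r) \<le> n" using n zero by simp
  qed (rule loop; auto)
qed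

section \<open>Reading off the single face\<close>

definition emitting :: "nat set \<Rightarrow> ram_state \<Rightarrow> bool" where
  "emitting T s \<longleftrightarrow> wmem s 1 0 = m \<and> wmem s 6 = X \<and> wmem s 8 = L \<and> support (wmem s 11) = T \<and>
     (\<forall>i. wmem s 11 i \<le> 1) \<and> wmem s 4 0 \<le> 2 * m \<and>
     wmem s 17 0 = ((\<lambda>f. L (edge_map T f)) ^^ wmem s 4 0) 0 \<and>
     (\<forall>j<wmem s 4 0. wmem s 5 j = X (((\<lambda>f. L (edge_map T f)) ^^ j) 0 div 2))"

lemma emit_step:
  assumes inv: "emitting T s" and less: "wmem s 4 0 < 2 * m"
    and n: "60 * (2 * m - wmem s 4 0) + r \<le> n"
  shows "wp B q emit_step (\<lambda>s n. emitting T s \<and> 60 * (2 * m - wmem s 4 0) + 10 + r \<le> n) s n"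
proof -
  define i f where "i = wmem s 4 0" and "f = ((\<lambda>f. L (edge_map T f)) ^^ i) 0"
  have s: "wmem s (Suc 0) 0 = m" "wmem s 4 0 = i" "wmem s 6 = X" "wmem s 8 = L"
    "wmem s 17 0 = f" "support (wmem s 11) = T" "\<And>i. wmem s 11 i \<le> Suc 0"
    "\<And>j. j < i \<Longrightarrow> wmem s 5 j = X (((\<lambda>f. L (edge_map T f)) ^^ j) 0 div 2)"
    using inv by (simp_all add: emitting_def i_def f_def)
  have "((\<lambda>f. L (edge_map T f)) ^^ j) 0 < 4 * m" for j
    using m by (induction j) (auto intro: L_simps)
  then have f: "f < 4 * m" by (simp add: f_def)
  then have lf: "L (opposite f) < 4 * m" "L (cross f) < 4 * m" by (simp_all add: L_simps)
  have i: "i < 2 * m" using less s by simp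
  have Xf: "X (f div 2) \<le> B" using f by (intro X_le) linarith
  have fit: "f + 6 \<le> B" "L (opposite f) \<le> B" "L (cross f) \<le> B" "Suc i \<le> B" "f div 2 \<le> B"
    "f div 4 \<le> B" "5 \<le> B"
    using f lf i B m by linarith+
  have fit11: "wmem s 11 (f div 4) \<le> B" using s(7)[of "f div 4"] fit by linarith
  have n': "60 * (2 * m - Suc i) + 60 + r \<le> n" using n i by (simp add: s)
  have out: "((wmem s 5)(i := X (f div 2))) j = X (((\<lambda>f. L (edge_map T f)) ^^ j) 0 div 2)" if "j < Suc i" for j
    using that s(8) by (auto simp: less_Suc_eq f_def)
  show ?thesis
  proof (cases "wmem s 11 (f div 4) = 0")
    case True
    then have e: "edge_map T f = opposite f" using s(6) by (auto simp: edge_map_def)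
    have "((\<lambda>f. L (edge_map T f)) ^^ Suc i) 0 = L (opposite f)" by (simp add: e flip: f_def)
    then have "emitting T (wstore 4 0 (Suc i) (wstore 17 0 (L (opposite f)) (wstore 5 i (X (f div 2)) s)))"
      unfolding emitting_def using s out i by (simp del: funpow.simps)
    then show ?thesis
      using True fit fit11 Xf n' i by (simp add: emit_step_def wp_simps s; intro conjI; linarith)
  next
    case False
    then have e: "edge_map T f = cross f" using s(6) by (auto simp: edge_map_def)
    have "((\<lambda>f. L (edge_map T f)) ^^ Suc i) 0 = L (cross f)" by (simp add: e flip: f_def)
    then have "emitting T (wstore 4 0 (Suc i) (wstore 17 0 (L (cross f)) (wstore 5 i (X (f div 2)) s)))"
      unfolding emitting_def using s out i by (simp del: funpow.simps)
    then show ?thesis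
      using False fit fit11 Xf n' i by (simp add: emit_step_def wp_simps s; intro conjI; linarith)
  qed
qed

text \<open>The loop counts to \<open>2 * m\<close>, the length given by \<open>turn_period\<close>
  for a map with one face, instead of waiting for the flag 0 to return.\<close>

lemma emit:
  assumes fr: "frame s" and T: "T = support (wmem s 11)" and n: "120 * m + 20 \<le> n"
  shows "wp B q emit (\<lambda>s n. wmem s 4 0 = 2 * m \<and>
     (\<forall>j<2 * m. wmem s 5 j = X (((\<lambda>f. L (edge_map T f)) ^^ j) 0 div 2))) s n"
proof -
  let ?I = "\<lambda>s n. emitting T s \<and> 60 * (2 * m - wmem s 4 0) + 10 + 0 \<le> n"
  let ?b = "WLess (var 4) (WConst 2 \<otimes> var 1)"
  let ?post = "\<lambda>s n. wmem s 4 0 = 2 * m \<and>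
     (\<forall>j<2 * m. wmem s 5 j = X (((\<lambda>f. L (edge_map T f)) ^^ j) 0 div 2))"
  have loop: "wp B q (Loop ?b emit_step) ?post s n" if "?I s n" for s n
    using that
  proof (rule wp_Loop[where I = ?I])
    fix s n assume I: "?I s n"
    then have s: "wmem s 1 0 = m" "wmem s 4 0 \<le> 2 * m" by (simp_all add: emitting_def)
    have c: "cval q s ?b \<longleftrightarrow> wmem s 4 0 < 2 * m" "1 + ctime ?b = 8" "cfits B s ?b"
      using s B m by simp_all
    have body: "wp B q emit_step ?I s (n - 8)" if "wmem s 4 0 < 2 * m"
    proof (rule emit_step)
      show "60 * (2 * m - wmem s 4 0) + 0 \<le> n - 8" using I by linarith
    qed (use I that in simp_all)
    have "?post s (n - 8)" if "\<not> wmem s 4 0 < 2 * m"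
    proof -
      have "wmem s 4 0 = 2 * m" using s that by simp
      then show ?thesis using I by (simp add: emitting_def)
    qed
    then show "cfits B s ?b \<and> 1 + ctime ?b \<le> n \<and>
      (if cval q s ?b then wp B q emit_step ?I s (n - (1 + ctime ?b)) else ?post s (n - (1 + ctime ?b)))"
      unfolding c(1,2) using c(3) I body by auto
  qed
  have "?I (wstore 17 0 0 s) (n - Suc (Suc (Suc 0)))"
    using fr T n by (auto simp: emitting_def frame_def)
  then have "wp B q (Loop ?b emit_step) ?post (wstore 17 0 0 s) (n - Suc (Suc (Suc 0)))" by (rule loop)
  then show ?thesis using n by (simp add: emit_def wp_simps)
qed

end

section \<open>From one face to a threading\<close>

definition endpoint :: "(nat \<times> nat) list \<Rightarrow> nat \<Rightarrow> nat" where
  "endpoint es h = (if even h then fst (es ! (h div 2)) else snd (es ! (h div 2)))"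

locale represented_graph =
  fixes V :: "'a set" and E :: "'a set set" and vs :: "'a list" and es :: "(nat \<times> nat) list"
  assumes graph: "threadable_graph V E" and rep: "represents vs es V E"
begin

definition flag_edge :: "nat \<Rightarrow> 'a set" where
  "flag_edge f = edge_of vs (es ! (f div 4))"

definition flag_vertex :: "nat \<Rightarrow> 'a" where
  "flag_vertex f = vs ! endpoint es (f div 2)"

lemma length_es: "length es = card E"
  using rep distinct_card[of "map (edge_of vs) es"] by (simp add: represents_def)

lemma endpoint_less:
  assumes "h < 2 * length es"
  shows "endpoint es h < length vs"
proof -
  have "h div 2 < length es" using assms by linarith
  then have "es ! (h div 2) \<in> set es" by (rule nth_mem)
  then show ?thesis using rep by (simp add: represents_def endpoint_def)
qed

lemma flag_endpoint_less: "f < 4 * length es \<Longrightarrow> endpoint es (f div 2) < length vs"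
  by (rule endpoint_less) linarith

lemma flag_vertex_eq_iff:
  "f < 4 * length es \<Longrightarrow> g < 4 * length es \<Longrightarrow>
    flag_vertex f = flag_vertex g \<longleftrightarrow> endpoint es (f div 2) = endpoint es (g div 2)"
  using rep flag_endpoint_less by (simp add: flag_vertex_def represents_def nth_eq_iff_index_eq)

lemma flag_vertex_in: "f < 4 * length es \<Longrightarrow> flag_vertex f \<in> V"
  using rep flag_endpoint_less by (auto simp: flag_vertex_def represents_def)

lemma flag_edge_in: "f < 4 * length es \<Longrightarrow> flag_edge f \<in> E"
  using rep by (auto simp: represents_def flag_edge_def)

lemma flag_edge_eq_iff:
  assumes "f < 4 * length es" "g < 4 * length es"
  shows "flag_edge f = flag_edge g \<longleftrightarrow> f div 4 = g div 4"
proof -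
  have "f div 4 < length es" "g div 4 < length es" using assms by linarith+
  moreover have "distinct (map (edge_of vs) es)" using rep by (simp add: represents_def)
  ultimately show ?thesis unfolding flag_edge_def by (metis length_map nth_eq_iff_index_eq nth_map)
qed

lemma flag_edge_ends: "flag_edge f = {flag_vertex f, flag_vertex (opposite f)}"
proof (cases f rule: flag_cases)
  case (1 e)
  then have "f div 4 = e" "f div 2 = 2 * e" "opposite f div 2 = 2 * e + 1"
    by (simp_all only: flag_maps_simps flag_div)
  then show ?thesis by (simp add: flag_edge_def flag_vertex_def endpoint_def edge_of_def)
next
  case (2 e)
  then have "f div 4 = e" "f div 2 = 2 * e" "opposite f div 2 = 2 * e + 1"
    by (simp_all only: flag_maps_simps flag_div)
  then show ?thesis by (simp add: flag_edge_def flag_vertex_def endpoint_def edge_of_def)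
next
  case (3 e)
  then have "f div 4 = e" "f div 2 = 2 * e + 1" "opposite f div 2 = 2 * e"
    by (simp_all only: flag_maps_simps flag_div)
  then show ?thesis
    by (simp add: flag_edge_def flag_vertex_def endpoint_def edge_of_def insert_commute)
next
  case (4 e)
  then have "f div 4 = e" "f div 2 = 2 * e + 1" "opposite f div 2 = 2 * e"
    by (simp_all only: flag_maps_simps flag_div)
  then show ?thesis
    by (simp add: flag_edge_def flag_vertex_def endpoint_def edge_of_def insert_commute)
qed

lemma flag_vertex_opposite:
  assumes "f < 4 * length es"
  shows "flag_vertex (opposite f) \<noteq> flag_vertex f"
proof
  assume "flag_vertex (opposite f) = flag_vertex f"
  then have "card (flag_edge f) = 1" by (simp add: flag_edge_ends)
  moreover have "card (flag_edge f) = 2"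
    using flag_edge_in[OF assms] graph by (auto simp: threadable_graph_def simple_graph_def)
  ultimately show False by simp
qed

lemma obtain_flag:
  assumes "e \<in> E" "v \<in> e"
  obtains f where "f < 4 * length es" "flag_edge f = e" "flag_vertex f = v"
proof -
  have "e \<in> set (map (edge_of vs) es)" using assms(1) rep by (simp add: represents_def)
  then obtain i where i: "i < length es" "e = edge_of vs (es ! i)"
    by (metis in_set_conv_nth length_map nth_map)
  have e: "flag_edge (4 * i) = e" "flag_edge (4 * i + 3) = e"
    using i(2) by (simp_all only: flag_edge_def flag_div)
  have "opposite (4 * i) = 4 * i + 3" by (simp only: flag_maps_simps)
  then have "v = flag_vertex (4 * i) \<or> v = flag_vertex (4 * i + 3)"
    using flag_edge_ends[of "4 * i"] e(1) assms(2) by auto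
  then show thesis using that[of "4 * i"] that[of "4 * i + 3"] e i(1) by auto
qed

lemma finite_E: "finite E"
  using rep by (auto simp: represents_def)

lemma degree: "v \<in> V \<Longrightarrow> 2 \<le> card (incident_edges E v)"
  using graph by (simp add: threadable_graph_def)

lemma two_edges: "2 \<le> length es"
proof -
  obtain v where "v \<in> V" using graph by (auto simp: threadable_graph_def connected_graph_def)
  then have "2 \<le> card (incident_edges E v)" by (rule degree)
  also have "\<dots> \<le> card E" using finite_E by (auto simp: incident_edges_def intro: card_mono)
  finally show ?thesis by (simp add: length_es)
qed

text \<open>By the minimum degree every vertex is an end of an edge. Vertex numbers are thereby
  bounded in terms of \<open>m\<close>, like everything else stored in a word.\<close>

lemma endpoint_le: "length vs \<le> 2 * length es"
proof -
  have "V \<subseteq> (\<lambda>h. vs ! endpoint es h) ` {..<2 * length es}"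
  proof
    fix v assume "v \<in> V"
    then have "incident_edges E v \<noteq> {}" using degree by fastforce
    then obtain e where "e \<in> E" "v \<in> e" by (auto simp: incident_edges_def)
    then obtain f where f: "f < 4 * length es" "flag_vertex f = v" by (rule obtain_flag)
    then have "f div 2 < 2 * length es" by linarith
    then show "v \<in> (\<lambda>h. vs ! endpoint es h) ` {..<2 * length es}"
      using f(2) by (auto simp: flag_vertex_def)
  qed
  then have "card V \<le> card {..<2 * length es}" by (meson card_image_le card_mono finite_imageI finite_lessThan le_trans)
  then show ?thesis using rep distinct_card[of vs] by (auto simp: represents_def)
qed

lemma flags_connected:
  assumes "f < 4 * length es" "g < 4 * length es"
  shows "(endpoint es (f div 2), endpoint es (g div 2))
    \<in> {(endpoint es (h div 2), endpoint es (opposite h div 2)) | h. h < 4 * length es}\<^sup>*"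
    (is "_ \<in> ?S\<^sup>*")
proof -
  have "(flag_vertex f, flag_vertex g) \<in> {(x, y). {x, y} \<in> E}\<^sup>*"
    using graph flag_vertex_in assms by (simp add: threadable_graph_def connected_graph_def)
  then have "\<exists>h < 4 * length es. flag_vertex h = flag_vertex g \<and> (endpoint es (f div 2), endpoint es (h div 2)) \<in> ?S\<^sup>*"
  proof induction
    case base
    then show ?case using assms by blast
  next
    case (step y z)
    then obtain h where h: "h < 4 * length es" "flag_vertex h = y"
      "(endpoint es (f div 2), endpoint es (h div 2)) \<in> ?S\<^sup>*" by blast
    have "{y, z} \<in> E" using step by simp
    then obtain k where k: "k < 4 * length es" "flag_edge k = {y, z}" "flag_vertex k = y"
      using obtain_flag[of "{y, z}" y] by auto
    then have z: "flag_vertex (opposite k) = z"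
      using flag_edge_ends[of k] flag_vertex_opposite[of k] by (auto simp: doubleton_eq_iff)
    have ok: "opposite k < 4 * length es" using k(1) by (simp add: flag_less_iff)
    have "endpoint es (k div 2) = endpoint es (h div 2)"
      using flag_vertex_eq_iff k h by metis
    moreover have "(endpoint es (k div 2), endpoint es (opposite k div 2)) \<in> ?S"
      using k(1) by blast
    ultimately have "(endpoint es (f div 2), endpoint es (opposite k div 2)) \<in> ?S\<^sup>*"
      using rtrancl.rtrancl_into_rtrancl[OF h(3)] by simp
    then show ?case using z ok by blast
  qed
  then obtain h where "h < 4 * length es" "flag_vertex h = flag_vertex g"
    "(endpoint es (f div 2), endpoint es (h div 2)) \<in> ?S\<^sup>*" by blast
  then show ?thesis using flag_vertex_eq_iff assms(2) by simp
qed

end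

locale threaded_graph = represented_graph + link_map "length es" "endpoint es" L
  for L :: "nat \<Rightarrow> nat" +
  fixes T :: "nat set"
  assumes reach_all: "f < 4 * length es \<Longrightarrow> reach T f"
begin

sublocale free_involutions "{..<4 * length es}" L "edge_map T"
  by unfold_locales (simp_all add: L_simps)

lemma zero_flag: "0 \<in> {..<4 * length es}"
  using two_edges by auto

lemma turn_period: "turn (2 * length es) 0 = 0"
  and turn_covers: "f < 4 * length es \<Longrightarrow>
    \<exists>i < 2 * length es. f = turn i 0 \<or> f = edge_map T (turn i 0)"
  using single_orbit[OF zero_flag] reach_all by (simp_all add: reach_def)

lemma turn_less: "turn i 0 < 4 * length es"
  using turn_closed[OF zero_flag] by simp

text \<open>The walk leaves its \<open>i\<close>-th vertex through the flag \<open>turn i 0\<close>;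
  \<open>edge_map T\<close> takes this to the flag of arrival at the next vertex, from which
  \<open>L\<close> leads on.\<close>

definition walk :: "'a list" where
  "walk = map (\<lambda>i. flag_vertex (turn i 0)) [0..<2 * length es]"

lemma length_walk [simp]: "length walk = 2 * length es"
  by (simp add: walk_def)

lemma turn_mod:
  assumes "i < 2 * length es"
  shows "turn (Suc i mod (2 * length es)) 0 = turn (Suc i) 0"
proof (cases "Suc i = 2 * length es")
  case True
  then show ?thesis unfolding True turn_period by simp
next
  case False
  then have "Suc i mod (2 * length es) = Suc i" using assms by (intro mod_less) linarith
  then show ?thesis by simp
qed

lemma walk_index_less: "k mod (2 * length es) < 2 * length es"
  using two_edges by (intro mod_less_divisor) linarith

lemma walk_nth: "i < 2 * length es \<Longrightarrow> walk ! i = flag_vertex (turn i 0)"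
  by (simp add: walk_def)

lemma walk_nth_Suc: "i < 2 * length es \<Longrightarrow> walk ! (Suc i mod (2 * length es)) = flag_vertex (turn (Suc i) 0)"
  using walk_nth[OF walk_index_less] turn_mod by simp

lemma flag_vertex_L: "f < 4 * length es \<Longrightarrow> flag_vertex (L f) = flag_vertex f"
  using L_simps(4) by (simp add: flag_vertex_def)

lemma flag_vertex_edge_map: "flag_vertex (edge_map T f) = flag_vertex (opposite f)"
  by (simp add: flag_vertex_def edge_map_def)

lemma flag_edge_edge_map: "flag_edge (edge_map T f) = flag_edge f"
  by (simp add: flag_edge_def)

lemma walk_edge_walk:
  assumes "i < 2 * length es"
  shows "walk_edge walk i = flag_edge (turn i 0)"
proof -
  have "flag_vertex (turn (Suc i) 0) = flag_vertex (opposite (turn i 0))"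
    using flag_vertex_L turn_less by (simp add: flag_vertex_edge_map)
  then show ?thesis
    using assms walk_nth_Suc walk_nth by (simp add: walk_edge_def flag_edge_ends del: turn_simps)
qed

lemma walk_edge_walk_Suc:
  "i < 2 * length es \<Longrightarrow> walk_edge walk (Suc i mod (2 * length es)) = flag_edge (turn (Suc i) 0)"
  using walk_edge_walk[OF walk_index_less] turn_mod by simp

lemma at_vertex:
  assumes "f < 4 * length es" "e \<in> incident_edges E (flag_vertex f)"
  obtains g where "g < 4 * length es" "flag_edge g = e" "flag_vertex g = flag_vertex f"
    "(f, g) \<in> (adj L flip)\<^sup>*"
proof -
  obtain g where g: "g < 4 * length es" "flag_edge g = e" "flag_vertex g = flag_vertex f"
    using assms(2) by (auto simp: incident_edges_def elim: obtain_flag)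
  then have "endpoint es (f div 2) = endpoint es (g div 2)" using flag_vertex_eq_iff assms(1) by metis
  then have "(f, g) \<in> (adj L flip)\<^sup>*" using linked g assms by (simp add: linked_def)
  then show thesis using that g by blast
qed

text \<open>Otherwise \<open>{f, flip f}\<close> would be closed under \<open>L\<close> and \<open>flip\<close>, and \<open>f\<close> would lie at a vertex
  of degree one.\<close>

lemma L_neq_flip:
  assumes f: "f < 4 * length es"
  shows "L f \<noteq> flip f"
proof
  assume eq: "L f = flip f"
  then have eq': "L (flip f) = f" using L_simps(2)[OF f] by simp
  have "incident_edges E (flag_vertex f) \<subseteq> {flag_edge f}"
  proof
    fix e assume "e \<in> incident_edges E (flag_vertex f)"
    with f obtain g where g: "flag_edge g = e" "(f, g) \<in> (adj L flip)\<^sup>*" by (rule at_vertex)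
    from g(2) have "g = f \<or> g = flip f"
      by induction (auto simp: adj_def eq eq')
    then show "e \<in> {flag_edge f}" using g(1) by (auto simp: flag_edge_def)
  qed
  then have "card (incident_edges E (flag_vertex f)) \<le> 1"
    by (metis card_mono finite.emptyI finite_insert is_singletonI is_singleton_altdef)
  then show False using degree[OF flag_vertex_in[OF f]] by simp
qed

text \<open>Each flag of the edge is excluded: \<open>opposite f\<close> and \<open>cross f\<close>
  lie at its other end, a different vertex; \<open>flip f\<close> is excluded by
  \<open>L_neq_flip\<close>, and \<open>f\<close> itself by parity.\<close>

lemma flag_edge_L:
  assumes f: "f < 4 * length es"
  shows "flag_edge (L f) \<noteq> flag_edge f"
proof
  assume "flag_edge (L f) = flag_edge f"
  then have "L f \<in> {f, opposite f, cross f, flip f}"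
    using flag_edge_eq_iff L_simps(1)[OF f] f by (simp only: same_edge_flags[symmetric])
  moreover have "flag_vertex (cross f) = flag_vertex (opposite f)" by (simp add: flag_vertex_def)
  ultimately show False
    using flag_vertex_L[OF f] flag_vertex_opposite[OF f] L_neq_flip[OF f] L_simps(5)[OF f] by auto
qed

lemma no_u_turn: "\<not> has_u_turn walk"
proof
  assume "has_u_turn walk"
  then obtain i where i: "i < 2 * length es" "flag_edge (turn i 0) = flag_edge (turn (Suc i) 0)"
    using walk_edge_walk walk_edge_walk_Suc by (auto simp: has_u_turn_def simp del: turn_simps)
  then show False
    using flag_edge_L[of "edge_map T (turn i 0)"] turn_less by (simp add: flag_edge_edge_map)
qed

text \<open>Either \<open>f\<close> is left by the walk, and its predecessor arrived in
  \<open>L f\<close>, or the walk arrives in \<open>f\<close> and leaves through \<open>L f\<close>.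
  Both edges are consecutive in either case.\<close>

lemma junction_edge:
  assumes f: "f < 4 * length es"
  shows "{flag_edge f, flag_edge (L f)} \<in> set_mset (junction_edges walk (flag_vertex f))"
proof -
  have "\<exists>i < 2 * length es. flag_vertex (turn (Suc i) 0) = flag_vertex f \<and>
    {flag_edge (turn i 0), flag_edge (turn (Suc i) 0)} = {flag_edge f, flag_edge (L f)}"
  proof -
    obtain j where j: "j < 2 * length es" "f = turn j 0 \<or> f = edge_map T (turn j 0)"
      using turn_covers[OF f] by blast
    show ?thesis
    proof (cases "f = turn j 0")
      case True
      obtain i where i: "i < 2 * length es" "f = turn (Suc i) 0"
      proof (cases j)
        case 0
        then show ?thesis
          using that[of "2 * length es - 1"] True turn_period j(1) by (simp del: turn_simps(2))
      next
        case (Suc i)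
        then show ?thesis using that[of i] j True by simp
      qed
      have "L f = edge_map T (turn i 0)" using i(2) turn_less by (simp add: L_simps)
      then show ?thesis using i by (auto simp: flag_edge_edge_map simp del: turn_simps)
    next
      case False
      then have "f = edge_map T (turn j 0)" "turn (Suc j) 0 = L f" using j(2) by simp_all
      then show ?thesis using j(1) flag_vertex_L[OF f] by (metis flag_edge_edge_map)
    qed
  qed
  then show ?thesis
    using walk_nth_Suc walk_edge_walk walk_edge_walk_Suc
    by (auto simp: junction_edges_def walk_pair_def walk_pair_vertex_def simp del: turn_simps
        intro!: image_eqI)
qed

text \<open>Steps along \<open>L\<close> and \<open>flip\<close> join all flags at \<open>v\<close>.
  The former are edges of the junction graph, the latter stay on the same edge of the graph.\<close>

lemma junction_connected:
  assumes "v \<in> V"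
  shows "connected_graph (junction_vertices E v) (set_mset (junction_edges walk v))"
  unfolding connected_graph_def junction_vertices_def
proof (intro conjI ballI)
  show "incident_edges E v \<noteq> {}" using degree[OF assms] by auto
  fix e e' assume e: "e \<in> incident_edges E v" and e': "e' \<in> incident_edges E v"
  obtain f where f: "f < 4 * length es" "flag_edge f = e" "flag_vertex f = v"
    using e by (auto simp: incident_edges_def elim: obtain_flag)
  obtain g where g: "flag_edge g = e'" "(f, g) \<in> (adj L flip)\<^sup>*"
    using at_vertex[OF f(1)] e' f(3) by metis
  let ?J = "{(x, y). {x, y} \<in> set_mset (junction_edges walk v)}"
  from g(2) have "g < 4 * length es \<and> flag_vertex g = v \<and> (e, flag_edge g) \<in> ?J\<^sup>*"
  proof induction
    case base
    then show ?case using f by simp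
  next
    case (step y z)
    then consider "z = L y" | "z = flip y" by (auto simp: adj_def)
    then show ?case
    proof cases
      case 1
      then have "(flag_edge y, flag_edge z) \<in> ?J" using junction_edge[of y] step.IH by simp
      with step.IH have "(e, flag_edge z) \<in> ?J\<^sup>*"
        by (blast intro: rtrancl.rtrancl_into_rtrancl)
      then show ?thesis using step.IH 1 L_simps(1) flag_vertex_L by simp
    next
      case 2
      then have "flag_edge z = flag_edge y" "flag_vertex z = flag_vertex y"
        by (simp_all add: flag_edge_def flag_vertex_def)
      then show ?thesis using step.IH 2 by simp
    qed
  qed
  then show "(e, e') \<in> ?J\<^sup>*" using g(1) by simp
qed

lemma threading_walk: "threading V E walk"
proof -
  have "walk_edge walk i \<in> E" if "i < 2 * length es" for i
    using that turn_less flag_edge_in by (simp add: walk_edge_walk)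
  moreover have "\<exists>i < 2 * length es. walk_edge walk i = e" if e: "e \<in> E" for e
  proof -
    have "e \<noteq> {}" using e graph by (auto simp: threadable_graph_def simple_graph_def)
    then obtain f where f: "f < 4 * length es" "flag_edge f = e"
      using e obtain_flag by blast
    then obtain i where "i < 2 * length es" "f = turn i 0 \<or> f = edge_map T (turn i 0)"
      using turn_covers by blast
    then show ?thesis using f walk_edge_walk flag_edge_edge_map by metis
  qed
  moreover have "walk \<noteq> []" using two_edges length_walk by fastforce
  ultimately show ?thesis
    using no_u_turn junction_connected by (simp add: threading_def closed_walk_def)
qed

end

section \<open>The approximation guarantee\<close>

context represented_graph
begin

lemma turns_finite: "finite (turns V E)"
proof (rule finite_subset)
  show "turns V E \<subseteq> Pow E"
    by (auto simp: turns_def turns_at_def incident_edges_def)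
qed (use finite_E in simp)

lemma walk_pair_in_turns:
  assumes "threading V E W" "i < length W"
  shows "walk_pair W i \<in> turns V E"
proof -
  let ?j = "Suc i mod length W"
  have j: "?j < length W" using assms(2) by (intro mod_less_divisor) linarith
  have E: "walk_edge W i \<in> E" "walk_edge W ?j \<in> E" and ne: "walk_edge W i \<noteq> walk_edge W ?j"
    using assms j by (auto simp: threading_def closed_walk_def has_u_turn_def)
  have v: "W ! ?j \<in> walk_edge W i" "W ! ?j \<in> walk_edge W ?j" by (simp_all add: walk_edge_def)
  moreover have "W ! ?j \<in> V"
    using v(1) E(1) graph by (auto simp: threadable_graph_def simple_graph_def)
  ultimately show ?thesis
    using E ne by (auto simp: turns_def turns_at_def incident_edges_def walk_pair_def)
qed

lemma threading_length: "threading V E W \<Longrightarrow> length es \<le> length W"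
proof -
  assume "threading V E W"
  then have "E \<subseteq> walk_edge W ` {..<length W}" by (auto simp: threading_def)
  then have "card E \<le> card {..<length W}"
    by (meson card_image_le card_mono finite_imageI finite_lessThan le_trans)
  then show ?thesis by (simp add: length_es)
qed

lemma walk_cost_le:
  assumes pos: "\<forall>t \<in> turns V E. \<alpha> t > 0"
    and W: "threading V E W" "length W = 2 * length es"
  shows "walk_cost \<alpha> W \<le> 2 * turn_cost_ratio V E \<alpha> * min_threading_cost V E \<alpha>"
proof -
  let ?max = "Max (\<alpha> ` turns V E)" and ?min = "Min (\<alpha> ` turns V E)"
  have "0 < length W" using W(2) two_edges by linarith
  then have ne: "turns V E \<noteq> {}" using walk_pair_in_turns[OF W(1)] by blast
  have fin: "finite (\<alpha> ` turns V E)" using turns_finite by simp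
  have "?min \<in> \<alpha> ` turns V E" "?max \<in> \<alpha> ` turns V E" using fin ne by (intro Min_in Max_in; simp)+
  then have min: "0 < ?min" and max: "0 < ?max" using pos by auto
  have lower: "real (length es) * ?min \<le> walk_cost \<alpha> W'" if "threading V E W'" for W'
  proof -
    have "real (length es) * ?min \<le> real (length W') * ?min"
      using threading_length[OF that] min by simp
    also have "\<dots> = (\<Sum>i<length W'. ?min)" by simp
    also have "\<dots> \<le> walk_cost \<alpha> W'"
      unfolding walk_cost_def using walk_pair_in_turns[OF that] fin by (intro sum_mono Min_le) auto
    finally show ?thesis .
  qed
  \<comment> \<open>\<open>W\<close> itself witnesses that the infimum is taken over a nonempty
    set.\<close>
  then have "real (length es) * ?min \<le> min_threading_cost V E \<alpha>"
    unfolding min_threading_cost_def using W(1) by (intro cINF_greatest) auto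
  then have "2 * (?max / ?min) * (real (length es) * ?min) \<le> 2 * (?max / ?min) * min_threading_cost V E \<alpha>"
    using min max by (intro mult_left_mono) auto
  moreover have "walk_cost \<alpha> W \<le> (\<Sum>i<length W. ?max)"
    unfolding walk_cost_def using walk_pair_in_turns[OF W(1)] fin by (intro sum_mono Max_ge) auto
  moreover have "(\<Sum>i<length W. ?max) = 2 * (?max / ?min) * (real (length es) * ?min)"
    using min W(2) by simp
  ultimately show ?thesis by (simp add: turn_cost_ratio_def)
qed

end

definition threading_program :: com where
  "threading_program = build_links ;; explore ;; emit"

lemma (in represented_graph) threading_program_correct:
  fixes q
  defines "m \<equiv> card E"
  shows "wp (m ^ 6) q threading_program
     (\<lambda>s n. \<exists>W. outputs_walk vs s W \<and> threading V E W \<and> length W = 2 * length es)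
     (input_state vs es) (800 * m)"
proof -
  let ?N = "endpoint es"
  have size: "length es = m" "2 \<le> m" using length_es two_edges by (simp_all add: m_def)
  \<comment> \<open>The origin of the exponent 6: \<open>m\<close> is at least 2, so
    \<open>m ^ 5\<close> is at least 32, and words up to \<open>32 * m\<close> are
    available.\<close>
  have "(2 :: nat) ^ 5 * m \<le> m ^ 5 * m" using size(2) by (intro mult_right_mono power_mono) auto
  then have B: "32 * m \<le> m ^ 6" by (simp flip: power_Suc2)
  have N: "?N h \<le> m ^ 6" if "h < 2 * m" for h
    using endpoint_less[of h] endpoint_le that B size by simp
  let ?U = "wmem (input_state vs es) 2" and ?W = "wmem (input_state vs es) 3"
  \<comment> \<open>\<open>V_eq\<close> is demanded for all indices, so the instance uses a vertex
    map read from memory, which is shown to agree with \<open>endpoint\<close> below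
    \<open>2 * m\<close>.\<close>
  let ?N' = "\<lambda>h. if even h then ?U (h div 2) else ?W (h div 2)"
  have N': "?N' h = ?N h" if "h < 2 * m" for h
    using that size(1) by (auto simp: input_state_def endpoint_def)
  interpret inp: ram_input "m ^ 6" q m ?U ?W ?N'
    by unfold_locales (use B N N' size(2) in auto)
  have start: "inp.building (input_state vs es)"
    unfolding inp.building_def using size
    by (simp add: input_state_def headed_def linked_0 fun_eq_iff)
  \<comment> \<open>The \<open>800 * m\<close> consist of \<open>300 * m\<close> for the links,
    \<open>300 * m\<close> for the search and \<open>120 * m\<close> for the output; the remaining
    \<open>80 * m\<close> absorb the additive constants.\<close>
  have "wp (m ^ 6) q build_links (\<lambda>s n. inp.building s \<and> wmem s 12 0 = 2 * m \<and> 420 * m + 40 \<le> n)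
      (input_state vs es) (800 * m)"
  proof (rule inp.build_links[OF start])
    show "150 * (2 * m - wmem (input_state vs es) 12 0) + (420 * m + 40) + 10 \<le> 800 * m"
      using size(2) by simp
  qed
  then show ?thesis
    unfolding threading_program_def wp_Seq
  proof (rule wp_mono)
    fix s n assume s: "inp.building s \<and> wmem s 12 0 = 2 * m \<and> 420 * m + 40 \<le> n"
    let ?L = "wmem s 8" and ?X = "wmem s 6"
    have X: "?X h = ?N h" if "h < 2 * m" for h
      using s that N' unfolding inp.building_def by metis
    have "linked (2 * m) ?N' ?L" using s unfolding inp.building_def by metis
    then have L: "linked (2 * m) ?N ?L" using N' by (auto intro: linked_cong[of _ ?N'])
    interpret prog: ram_links m ?N ?L "m ^ 6" q ?X
      by unfold_locales (use B size N X L in auto)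
    have zero: "wmem s 4 = (\<lambda>_. 0)" "wmem s 9 = (\<lambda>_. 0)" "wmem s 11 = (\<lambda>_. 0)"
        "wmem s 15 = (\<lambda>_. 0)" "wmem s 16 = (\<lambda>_. 0)" "wmem s 17 = (\<lambda>_. 0)" "wmem s 1 0 = m"
      using s unfolding inp.building_def by simp_all
    have fr: "prog.frame s" using zero by (simp add: prog.frame_def support_def bij_betw_def)
    show "wp (m ^ 6) q explore (wp (m ^ 6) q emit
        (\<lambda>s n. \<exists>W. outputs_walk vs s W \<and> threading V E W \<and> length W = 2 * length es)) s n"
    proof (rule wp_mono[OF prog.explore[OF fr]])
      show "300 * m + 20 + (120 * m + 20) \<le> n" using s by simp
      fix s' n' assume s': "prog.frame s' \<and> prog.explored (support (wmem s' 9)) (support (wmem s' 11)) \<and>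
        (\<forall>g\<in>support (wmem s' 9). cross g \<in> support (wmem s' 9)) \<and> 120 * m + 20 \<le> n'"
      let ?T = "support (wmem s' 11)"
      have "prog.reach ?T f" if "f < 4 * m" for f
        using prog.explored_all[of "support (wmem s' 9)" ?T f] s' flags_connected[unfolded size(1)] that
        by blast
      then interpret threaded_graph V E vs es ?L ?T
        by unfold_locales (use L size(1) in auto)
      show "wp (m ^ 6) q emit
        (\<lambda>s n. \<exists>W. outputs_walk vs s W \<and> threading V E W \<and> length W = 2 * length es) s' n'"
      proof (rule wp_mono[OF prog.emit[OF _ refl]])
        show "prog.frame s'" "120 * m + 20 \<le> n'" using s' by simp_all
        fix s'' :: ram_state and n'' assume s'': "wmem s'' 4 0 = 2 * m \<and>
          (\<forall>j<2 * m. wmem s'' 5 j = ?X (((\<lambda>f. ?L (edge_map ?T f)) ^^ j) 0 div 2))"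
        have "outputs_walk vs s'' walk"
          unfolding outputs_walk_def
        proof (intro conjI allI impI)
          show "wmem s'' 4 0 = length walk" using s'' size(1) by simp
          fix i assume "i < length walk"
          then have i: "i < 2 * m" using size(1) by simp
          have f: "turn i 0 div 2 < 2 * m" using turn_less[of i] size(1) by linarith
          have "wmem s'' 5 i = ?N (turn i 0 div 2)" using s'' i X[OF f] by (simp add: turn_def)
          then show "wmem s'' 5 i < length vs" "vs ! wmem s'' 5 i = walk ! i"
            using endpoint_less[of "turn i 0 div 2"] f i walk_nth[of i] size(1)
            by (simp_all add: flag_vertex_def)
        qed
        then show "\<exists>W. outputs_walk vs s'' W \<and> threading V E W \<and> length W = 2 * length es"
          using threading_walk length_walk by blast
      qed
    qed (use zero in simp_all)
  qed
qed

theorem theorem24: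
  shows "\<exists>(p :: com) (k :: nat) (T :: nat \<Rightarrow> real). T \<in> O(\<lambda>m. real m) \<and>
    (\<forall>(V :: 'a set) (E :: 'a set set) (\<alpha> :: 'a set set \<Rightarrow> real) vs es.
       threadable_graph V E \<longrightarrow> (\<forall>t \<in> turns V E. \<alpha> t > 0) \<longrightarrow> represents vs es V E \<longrightarrow>
       (\<exists>t s W.
          ram_exec (card E ^ k) (turn_query \<alpha> vs es V E) p (input_state vs es) t s \<and>
          real t \<le> T (card E) \<and>
          outputs_walk vs s W \<and>
          threading V E W \<and>
          walk_cost \<alpha> W \<le> 2 * turn_cost_ratio V E \<alpha> * min_threading_cost V E \<alpha>))"
proof (rule exI[of _ threading_program], rule exI[of _ 6], rule exI[of _ "\<lambda>m. 800 * real m"],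
    intro conjI allI impI)
  show "(\<lambda>m. 800 * real m) \<in> O(\<lambda>m. real m)" by simp
  fix V :: "'a set" and E and \<alpha> :: "'a set set \<Rightarrow> real" and vs es
  assume graph: "threadable_graph V E" and pos: "\<forall>t \<in> turns V E. \<alpha> t > 0"
    and rep: "represents vs es V E"
  interpret represented_graph V E vs es using graph rep by unfold_locales
  obtain t s W where "ram_exec (card E ^ 6) (turn_query \<alpha> vs es V E) threading_program (input_state vs es) t s"
    "t \<le> 800 * card E" "outputs_walk vs s W" "threading V E W" "length W = 2 * length es"
    using threading_program_correct unfolding wp_def by blast
  moreover from this(2) have "real t \<le> 800 * real (card E)" by linarith
  ultimately show "\<exists>t s W.
          ram_exec (card E ^ 6) (turn_query \<alpha> vs es V E) threading_program (input_state vs es) t s \<and>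
          real t \<le> 800 * real (card E) \<and>
          outputs_walk vs s W \<and>
          threading V E W \<and>
          walk_cost \<alpha> W \<le> 2 * turn_cost_ratio V E \<alpha> * min_threading_cost V E \<alpha>"
    using walk_cost_le[OF pos] by blast
qed

end
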